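(* Let $G$ be a commutative Polish group. Then $\perp^{\mathrm{Haar}}=\perp^{o}=\perp^{nm}$. That is, for every $G$-structure $M$ and all finite tuples or subsets $a,b,C$ of $M$, the relations $a\mathrel{\perp}^{\mathrm{Haar}}_C b$, $a\mathrel{\perp}^{o}_C b$ and $a\mathrel{\perp}^{nm}_C b$ are equivalent.
   Context: A $G$-structure is a set $M$ with an action of $G$ such that the stabilizer $G_a$ is closed in $G$ for each $a\in M$. For a subset or tuple $A$ of $M$, $G_A$ is the pointwise stabilizer of $A$; $Ca$ denotes the union of $C$ with (the entries of) $a$. For a Polish group $H$, a Borel subset $X\subset H$ is Haar null if there is a Borel probability measure $\mu$ on $H$ such that $\mu(gXh)=0$ for all $g,h\in H$; an arbitrary subset of $H$ is Haar null if it is contained in a Haar null Borel set. Let $\mathcal{I}^{\mathrm{Haar}}_H$ denote the $\sigma$-ideal of Haar null subsets of $H$. For finite tuples or subsets $a,b,C$ of $M$: - $a\mathrel{\perp}^{\mathrm{Haar}}_C b$ means $G_{Ca}G_{Cb}\notin\mathcal{I}^{\mathrm{Haar}}_{G_C}$ (i.e. it is not Haar null in $G_C$); - $a\mathrel{\perp}^{nm}_C b$ means $G_{Ca}G_{Cb}$ is non-meager in $G_C$; - $a\mathrel{\perp}^{o}_C b$ means $G_{Ca}G_{Cb}$ is open in $G_C$. *)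

theory Defs
  imports "HOL-Probability.Probability_Measure" "HOL-Algebra.Group_Action"
begin

section \<open>Polish groups\<close>

locale polish_group = group G for G (structure) +
  fixes T :: "'a topology"
  assumes topspace_eq: "topspace T = carrier G"
    and separable: "separable_space T"
    and completely_metrizable: "completely_metrizable_space T"
    and continuous_mult: "continuous_map (prod_topology T T) T (\<lambda>(x, y). x \<otimes> y)"
    and continuous_inv: "continuous_map T T (\<lambda>x. inv x)"

section \<open>Meager sets\<close>

definition nowhere_dense_in :: "'a topology \<Rightarrow> 'a set \<Rightarrow> bool" where
  "nowhere_dense_in T X \<longleftrightarrow> X \<subseteq> topspace T \<and> T interior_of (T closure_of X) = {}"

definition meager_in :: "'a topology \<Rightarrow> 'a set \<Rightarrow> bool" where
  "meager_in T X \<longleftrightarrow> (\<exists>N :: nat \<Rightarrow> 'a set. (\<forall>n. nowhere_dense_in T (N n)) \<and> X = (\<Union>n. N n))"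

section \<open>Haar null sets\<close>

definition borel_sets_of :: "'a topology \<Rightarrow> 'a set set" where
  "borel_sets_of T = sigma_sets (topspace T) {U. openin T U}"

definition borel_prob_measure :: "'a topology \<Rightarrow> 'a measure \<Rightarrow> bool" where
  "borel_prob_measure T \<mu> \<longleftrightarrow> prob_space \<mu> \<and> sets \<mu> = borel_sets_of T"

text \<open>
  In a topological group all two-sided translates of a Borel set are Borel, so the default value
  \<open>0\<close> of \<^const>\<open>emeasure\<close> on non-measurable sets plays no role here.
\<close>

definition Haar_null_Borel :: "('a, 'b) monoid_scheme \<Rightarrow> 'a topology \<Rightarrow> 'a set \<Rightarrow> bool" where
  "Haar_null_Borel H T X \<longleftrightarrow>
     X \<in> borel_sets_of T \<and>
     (\<exists>\<mu>. borel_prob_measure T \<mu> \<and>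
        (\<forall>g \<in> carrier H. \<forall>h \<in> carrier H. emeasure \<mu> ((g <#\<^bsub>H\<^esub> X) #>\<^bsub>H\<^esub> h) = 0))"

definition Haar_ideal :: "('a, 'b) monoid_scheme \<Rightarrow> 'a topology \<Rightarrow> 'a set set" where
  "Haar_ideal H T = {X. \<exists>B. X \<subseteq> B \<and> Haar_null_Borel H T B}"

section \<open>\<open>G\<close>-structures and the independence relations\<close>

text \<open>
  Only the stabilizers of points are required to be closed: no topology is given on \<open>M\<close> and no
  joint continuity of the action is assumed.
\<close>

definition G_structure ::
  "('a, 'b) monoid_scheme \<Rightarrow> 'a topology \<Rightarrow> 'm set \<Rightarrow> ('a \<Rightarrow> 'm \<Rightarrow> 'm) \<Rightarrow> bool" where
  "G_structure G T M \<phi> \<longleftrightarrow>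
     group_action G M \<phi> \<and> (\<forall>x \<in> M. closedin T (stabilizer G \<phi> x))"

text \<open>The arguments of the relations may be tuples or subsets, in any combination.\<close>

datatype 'm tuple_or_subset = Tuple "'m list" | Subset "'m set"

fun entries :: "'m tuple_or_subset \<Rightarrow> 'm set" where
  "entries (Tuple xs) = set xs"
| "entries (Subset A) = A"

definition finite_in :: "'m set \<Rightarrow> 'm tuple_or_subset \<Rightarrow> bool" where
  "finite_in M a \<longleftrightarrow> finite (entries a) \<and> entries a \<subseteq> M"

definition pointwise_stabilizer ::
  "('a, 'b) monoid_scheme \<Rightarrow> ('a \<Rightarrow> 'm \<Rightarrow> 'm) \<Rightarrow> 'm set \<Rightarrow> 'a set" where
  "pointwise_stabilizer G \<phi> A = {g \<in> carrier G. \<forall>x \<in> A. \<phi> g x = x}"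

text \<open>
  For \<open>C\<close>, \<open>a\<close>, \<open>b\<close> as below: the topological group \<open>G\<^sub>C\<close> (with the subspace topology) and the
  product set \<open>G\<^sub>C\<^sub>a G\<^sub>C\<^sub>b\<close>.
\<close>

definition stab_group ::
  "('a, 'b) monoid_scheme \<Rightarrow> ('a \<Rightarrow> 'm \<Rightarrow> 'm) \<Rightarrow> 'm tuple_or_subset \<Rightarrow> ('a, 'b) monoid_scheme" where
  "stab_group G \<phi> C = G\<lparr>carrier := pointwise_stabilizer G \<phi> (entries C)\<rparr>"

definition stab_topology ::
  "('a, 'b) monoid_scheme \<Rightarrow> 'a topology \<Rightarrow> ('a \<Rightarrow> 'm \<Rightarrow> 'm) \<Rightarrow> 'm tuple_or_subset \<Rightarrow> 'a topology" where
  "stab_topology G T \<phi> C = subtopology T (pointwise_stabilizer G \<phi> (entries C))"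

definition stab_product ::
  "('a, 'b) monoid_scheme \<Rightarrow> ('a \<Rightarrow> 'm \<Rightarrow> 'm) \<Rightarrow>
     'm tuple_or_subset \<Rightarrow> 'm tuple_or_subset \<Rightarrow> 'm tuple_or_subset \<Rightarrow> 'a set" where
  "stab_product G \<phi> a C b =
     pointwise_stabilizer G \<phi> (entries C \<union> entries a) <#>\<^bsub>G\<^esub>
     pointwise_stabilizer G \<phi> (entries C \<union> entries b)"

text \<open>The argument order \<open>a C b\<close> follows the notation with \<open>C\<close> as the index of the symbol between
  \<open>a\<close> and \<open>b\<close>.\<close>

definition indep_Haar ::
  "('a, 'b) monoid_scheme \<Rightarrow> 'a topology \<Rightarrow> ('a \<Rightarrow> 'm \<Rightarrow> 'm) \<Rightarrow>
     'm tuple_or_subset \<Rightarrow> 'm tuple_or_subset \<Rightarrow> 'm tuple_or_subset \<Rightarrow> bool" where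
  "indep_Haar G T \<phi> a C b \<longleftrightarrow>
     stab_product G \<phi> a C b \<notin> Haar_ideal (stab_group G \<phi> C) (stab_topology G T \<phi> C)"

definition indep_nm ::
  "('a, 'b) monoid_scheme \<Rightarrow> 'a topology \<Rightarrow> ('a \<Rightarrow> 'm \<Rightarrow> 'm) \<Rightarrow>
     'm tuple_or_subset \<Rightarrow> 'm tuple_or_subset \<Rightarrow> 'm tuple_or_subset \<Rightarrow> bool" where
  "indep_nm G T \<phi> a C b \<longleftrightarrow>
     \<not> meager_in (stab_topology G T \<phi> C) (stab_product G \<phi> a C b)"

definition indep_o ::
  "('a, 'b) monoid_scheme \<Rightarrow> 'a topology \<Rightarrow> ('a \<Rightarrow> 'm \<Rightarrow> 'm) \<Rightarrow>
     'm tuple_or_subset \<Rightarrow> 'm tuple_or_subset \<Rightarrow> 'm tuple_or_subset \<Rightarrow> bool" where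
  "indep_o G T \<phi> a C b \<longleftrightarrow>
     openin (stab_topology G T \<phi> C) (stab_product G \<phi> a C b)"

end

theory Submission
  imports Defs "HOL-Probability.Infinite_Product_Measure"
begin

text \<open>
  Write \<open>H = G\<^sub>C\<close>, a closed subgroup of \<open>G\<close> and hence an abelian Polish group, and let \<open>A\<close> and \<open>B\<close>
  be the closed subgroups \<open>G\<^sub>C\<^sub>a\<close> and \<open>G\<^sub>C\<^sub>b\<close> of \<open>H\<close>. Commutativity makes \<open>P = A B\<close> a subgroup, and
  moreover the image of the Polish group \<open>A \<times> B\<close> under the continuous homomorphism
  \<open>(x, y) \<mapsto> x y\<close>. The theorem says that such a \<open>P\<close> is open, non-meager and not Haar null all at once
  or not at all.

  An open \<open>P\<close> is non-meager by the Baire category theorem, and it is not Haar null because countably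
  many of its cosets cover \<open>H\<close>.

  A non-meager \<open>P\<close> is open: this is the open mapping principle \<open>nonmeager_hom_image_open\<close>. By a
  Lindelof argument the homomorphism is nearly open (\<open>nonmeager_hom_nearly_open\<close>). Completeness of
  \<open>A \<times> B\<close> then shows that \<open>P\<close> is comeager in the interior \<open>W\<close> of its closure
  (\<open>nearly_open_imp_comeager_image\<close>). If \<open>h \<in> W\<close> were outside \<open>P\<close>, the disjoint sets \<open>P\<close> and \<open>h P\<close>
  would both be comeager in \<open>W \<inter> h W\<close>, so \<open>W\<close> is contained in \<open>P\<close>.

  A meager \<open>P\<close> is Haar null (\<open>meager_analytic_subgroup_Haar_null\<close>). Neighbourhoods of the identity are
  non-meager, so there is a sequence \<open>g\<^sub>n\<close> tending to the identity with \<open>g\<^sub>n g\<^sub>m \<notin> P\<close> and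
  \<open>g\<^sub>n g\<^sub>m\<^sup>-\<^sup>1 \<notin> P\<close> for \<open>m < n\<close>, so fast that the random product of the \<open>g\<^sub>n\<close> over those \<open>n\<close> for which
  the \<open>n\<close>-th toss of a fair coin shows heads converges. Let \<open>\<mu>\<close> be the distribution of this product.
  Flipping the \<open>n\<close>-th coin preserves probabilities and multiplies the product by \<open>g\<^sub>n\<close> or its inverse.
  Hence the events that the product lies in a given coset of \<open>P\<close> after the \<open>n\<close>-th flip are pairwise
  disjoint for different \<open>n\<close>, and they have the same probability, which must therefore be \<open>0\<close>.

  This argument treats \<open>P\<close> as if it were Borel, whereas Haar nullness asks for one Borel set
  \<open>B \<supseteq> P\<close> all of whose translates are \<open>\<mu>\<close>-null. The argument uses only that \<open>B\<close> is disjoint from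
  \<open>e B\<close> for the countably many quotients \<open>e \<notin> P\<close> of the elements \<open>g\<^sub>n\<^sup>\<plusminus>\<^sup>1\<close>. Such a \<open>B\<close> is obtained by
  separating the disjoint analytic sets \<open>P\<close> and \<open>e P\<close> by Borel sets (\<open>Lusin_separation\<close>,
  \<open>analytic_subgroup_borel_hull\<close>).
\<close>

section \<open>Meager sets\<close>

lemma nowhere_dense_in_subset:
  assumes "nowhere_dense_in T Y" and "X \<subseteq> Y"
  shows "nowhere_dense_in T X"
proof -
  have "T interior_of (T closure_of X) \<subseteq> T interior_of (T closure_of Y)"
    by (intro interior_of_mono closure_of_mono assms)
  then show ?thesis
    using assms unfolding nowhere_dense_in_def by blast
qed

lemma meager_in_subset:
  assumes "meager_in T Y" and "X \<subseteq> Y"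
  shows "meager_in T X"
proof -
  obtain N :: "nat \<Rightarrow> _" where N: "\<And>n. nowhere_dense_in T (N n)" "Y = (\<Union>n. N n)"
    using assms(1) unfolding meager_in_def by blast
  have "nowhere_dense_in T (N n \<inter> X)" for n
    by (rule nowhere_dense_in_subset[OF N(1)]) auto
  moreover have "X = (\<Union>n. N n \<inter> X)"
    using N(2) assms(2) by blast
  ultimately show ?thesis
    unfolding meager_in_def by (intro exI[of _ "\<lambda>n. N n \<inter> X"]) blast
qed

lemma nowhere_dense_imp_meager_in: "nowhere_dense_in T X \<Longrightarrow> meager_in T X"
  unfolding meager_in_def by (rule exI[of _ "\<lambda>_. X"]) auto

lemma meager_in_empty: "meager_in T {}"
  by (rule nowhere_dense_imp_meager_in) (simp add: nowhere_dense_in_def)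

lemma meager_in_Union:
  assumes "countable \<X>" and "\<And>X. X \<in> \<X> \<Longrightarrow> meager_in T X"
  shows "meager_in T (\<Union>\<X>)"
proof (cases "\<X> = {}")
  case True
  then show ?thesis by (simp add: meager_in_empty)
next
  case False
  have "\<exists>N :: nat \<Rightarrow> _. (\<forall>n. nowhere_dense_in T (N n)) \<and> from_nat_into \<X> k = (\<Union>n. N n)" for k
    using assms(2)[OF from_nat_into[OF False]] unfolding meager_in_def by blast
  then obtain N :: "nat \<Rightarrow> nat \<Rightarrow> _" where N: "\<And>k n. nowhere_dense_in T (N k n)"
      "\<And>k. from_nat_into \<X> k = (\<Union>n. N k n)"
    by metis
  have "\<Union>\<X> = (\<Union>k. from_nat_into \<X> k)"
    using range_from_nat_into[OF False assms(1)] by simp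
  also have "\<dots> = (\<Union>m. case_prod N (prod_decode m))"
  proof -
    have "\<exists>m. y \<in> case_prod N (prod_decode m)" if "y \<in> N k n" for y k n
      using that by (intro exI[of _ "prod_encode (k, n)"]) simp
    then show ?thesis
      unfolding N(2) by (fastforce split: prod.splits)
  qed
  finally show ?thesis
    unfolding meager_in_def using N(1) by (intro exI[of _ "\<lambda>m. case_prod N (prod_decode m)"]) (auto split: prod.splits)
qed

lemma meager_in_Un: "meager_in T X \<Longrightarrow> meager_in T Y \<Longrightarrow> meager_in T (X \<union> Y)"
  using meager_in_Union[of "{X, Y}" T] by auto

lemma not_meager_in_open:
  assumes "completely_metrizable_space T" and "openin T U" and "U \<noteq> {}"
  shows "\<not> meager_in T U"
proof
  assume "meager_in T U"
  then obtain N :: "nat \<Rightarrow> _" where N: "\<And>n. nowhere_dense_in T (N n)" "U = (\<Union>n. N n)"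
    unfolding meager_in_def by blast
  have "T interior_of \<Union>(range (\<lambda>n. T closure_of N n)) = {}"
    using assms(1) N(1) by (intro Baire_category_alt) (auto simp: nowhere_dense_in_def)
  moreover have "U \<subseteq> \<Union>(range (\<lambda>n. T closure_of N n))"
    using N closure_of_subset unfolding nowhere_dense_in_def by fastforce
  ultimately show False
    using assms(2,3) interior_of_maximal[of U _ T] by blast
qed

lemma meager_in_homeomorphic_image:
  assumes "homeomorphic_map T T' f" and "meager_in T X"
  shows "meager_in T' (f ` X)"
proof -
  obtain N :: "nat \<Rightarrow> _" where N: "\<And>n. nowhere_dense_in T (N n)" "X = (\<Union>n. N n)"
    using assms(2) unfolding meager_in_def by blast
  have "nowhere_dense_in T' (f ` N n)" for n
    using N(1)[of n] homeomorphic_imp_surjective_map[OF assms(1)]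
    unfolding nowhere_dense_in_def
    by (auto simp: homeomorphic_map_closure_of[OF assms(1)]
        homeomorphic_map_interior_of[OF assms(1)] closure_of_subset_topspace)
  then show ?thesis
    unfolding meager_in_def using N(2) by (intro exI[of _ "\<lambda>n. f ` N n"]) auto
qed

section \<open>Separable completely metrizable spaces\<close>

text \<open>
  A sieve of countable open covers in which nested cells that stay nonempty shrink to a point. It
  carries what the two tree arguments below need from a complete metric: a property that passes
  from a set to one of the pieces of a countable cover can be pursued down to a point.
\<close>

definition complete_sieve :: "'a topology \<Rightarrow> (nat \<Rightarrow> nat \<Rightarrow> 'a set) \<Rightarrow> bool" where
  "complete_sieve Z W \<longleftrightarrow>
     (\<forall>n i. openin Z (W n i)) \<and> (\<forall>n. (\<Union>i. W n i) = topspace Z) \<and>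
     (\<forall>V. V 0 = topspace Z \<and> (\<forall>n. V n \<noteq> {} \<and> (\<exists>i. V (Suc n) = V n \<inter> W n i)) \<longrightarrow>
        (\<exists>z \<in> topspace Z. \<forall>U. openin Z U \<and> z \<in> U \<longrightarrow> (\<exists>n. V n \<subseteq> U)))"

lemma complete_sieve_open: "complete_sieve Z W \<Longrightarrow> openin Z (W n i)"
  unfolding complete_sieve_def by simp

lemma complete_sieve_cover: "complete_sieve Z W \<Longrightarrow> (\<Union>i. W n i) = topspace Z"
  unfolding complete_sieve_def by simp

lemma complete_sieve_image_split:
  assumes "complete_sieve Z W" and "V \<subseteq> topspace Z"
  shows "f ` V = (\<Union>i. f ` (V \<inter> W n i))"
proof -
  have "f ` V = f ` (V \<inter> (\<Union>i. W n i))"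
    using assms complete_sieve_cover[OF assms(1)] by (simp add: Int_absorb2)
  then show ?thesis
    by (simp only: Int_UN_distrib image_UN)
qed

lemma complete_sieve_converges:
  assumes "complete_sieve Z W" and "V 0 = topspace Z" and "\<And>n. V n \<noteq> {}"
    and "\<And>n. \<exists>i. V (Suc n) = V n \<inter> W n i"
  obtains z where "z \<in> topspace Z" and "\<And>U. openin Z U \<Longrightarrow> z \<in> U \<Longrightarrow> \<exists>n. V n \<subseteq> U"
  using assms unfolding complete_sieve_def by metis

text \<open>
  The \<open>n\<close>-th cover consists of the balls of radius \<open>1 / (n + 1)\<close> around a countable dense set.
\<close>

lemma separable_completely_metrizable_imp_complete_sieve:
  assumes "completely_metrizable_space Z" and "separable_space Z"
  shows "\<exists>W. complete_sieve Z W"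
proof -
  obtain M d where "Metric_space M d" and compl: "Metric_space.mcomplete M d"
    and Z: "Z = Metric_space.mtopology M d"
    using assms(1) unfolding completely_metrizable_space_def by blast
  interpret Metric_space M d by fact
  obtain C where C: "countable C" "C \<subseteq> M" "mtopology closure_of C = M"
    using assms(2) unfolding Z separable_space_def by auto
  define q where "q = from_nat_into C"
  define W where "W n i = (if C = {} then {} else mball (q i) (1 / real (Suc n)))" for n i :: nat
  have cover: "(\<Union>i. W n i) = M" for n
  proof
    show "(\<Union>i. W n i) \<subseteq> M"
      unfolding W_def by auto
    show "M \<subseteq> (\<Union>i. W n i)"
    proof
      fix x assume x: "x \<in> M"
      have "x \<in> mtopology closure_of C" using x C by simp
      moreover have "1 / real (Suc n) > 0" by simp
      ultimately obtain c where c: "c \<in> C" "c \<in> mball x (1 / real (Suc n))"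
        unfolding metric_closure_of by blast
      obtain i where "q i = c"
        unfolding q_def using from_nat_into_surj[OF C(1) c(1)] by blast
      then have "x \<in> W n i"
        using c by (auto simp: W_def commute)
      then show "x \<in> (\<Union>i. W n i)" by blast
    qed
  qed
  have conv: "\<exists>z \<in> M. \<forall>U. openin mtopology U \<and> z \<in> U \<longrightarrow> (\<exists>n. V n \<subseteq> U)"
    if V: "V 0 = M" "\<And>n. V n \<noteq> {}" "\<And>n. \<exists>i. V (Suc n) = V n \<inter> W n i" for V
  proof -
    have "decseq V"
      using V(3) by (auto intro!: decseq_SucI)
    then have VM: "V n \<subseteq> M" for n
      using V(1) by (metis decseqD le0)
    have small: "d x y < 2 / real (Suc N)" if "x \<in> V (Suc N)" "y \<in> V (Suc N)" for x y N
    proof -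
      obtain i where "V (Suc N) = V N \<inter> W N i" using V(3) by blast
      then have "x \<in> mball (q i) (1 / real (Suc N))" "y \<in> mball (q i) (1 / real (Suc N))"
        using that by (auto simp: W_def split: if_splits)
      then have "x \<in> M" "y \<in> M" "q i \<in> M" "d x (q i) < 1 / real (Suc N)"
        "d (q i) y < 1 / real (Suc N)"
        by (auto simp: commute)
      then show ?thesis using triangle[of x "q i" y] by simp
    qed
    have "\<forall>n. \<exists>x. x \<in> V n" using V(2) by blast
    then obtain x where x: "\<And>n. x n \<in> V n" by metis
    have inv_small: "\<exists>N. 2 / real (Suc N) < e" if "e > 0" for e :: real
      using reals_Archimedean[of "e/2"] that by (auto simp: field_simps)
    have "MCauchy x"
      unfolding MCauchy_def
    proof (intro conjI strip)
      show "range x \<subseteq> M" using x VM by blast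
      fix e :: real assume "e > 0"
      then obtain N where N: "2 / real (Suc N) < e" using inv_small by blast
      \<comment> \<open>All points from stage \<open>Suc N\<close> on lie in one ball of radius \<open>1 / Suc N\<close>.\<close>
      have "d (x n) (x n') < e" if "Suc N \<le> n" "Suc N \<le> n'" for n n'
      proof -
        have "x n \<in> V (Suc N)" "x n' \<in> V (Suc N)"
          using x that decseqD[OF \<open>decseq V\<close>] by blast+
        then show ?thesis using small N by fastforce
      qed
      then show "\<exists>N. \<forall>n n'. N \<le> n \<longrightarrow> N \<le> n' \<longrightarrow> d (x n) (x n') < e" by blast
    qed
    then obtain z where z: "limitin mtopology x z sequentially"
      using compl unfolding mcomplete_def by blast
    have zM: "z \<in> M" using z by (simp add: limit_metric_sequentially)
    have "\<exists>n. V n \<subseteq> U" if U: "openin mtopology U" "z \<in> U" for U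
    proof -
      obtain r where r: "r > 0" "mball z r \<subseteq> U"
        using U unfolding openin_mtopology by blast
      obtain N where N: "2 / real (Suc N) < r / 2" using inv_small[of "r/2"] r by auto
      obtain K where K: "\<And>n. n \<ge> K \<Longrightarrow> d (x n) z < r / 2"
        using z r unfolding limit_metric_sequentially by (meson half_gt_zero)
      have "y \<in> U" if y: "y \<in> V (Suc N)" for y
      proof -
        define m where "m = max K (Suc N)"
        have "x m \<in> V (Suc N)"
          using x[of m] decseqD[OF \<open>decseq V\<close>, of "Suc N" m] unfolding m_def by auto
        then have "d y (x m) < r / 2" using small[OF y] N by fastforce
        moreover have "d (x m) z < r / 2" using K unfolding m_def by simp
        ultimately have "d y z < r"
          using triangle[of y "x m" z] y x VM zM by (smt (verit) field_sum_of_halves in_mono)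
        then have "y \<in> mball z r" using y VM zM by (auto simp: commute)
        then show ?thesis using r by blast
      qed
      then show ?thesis by blast
    qed
    then show ?thesis using zM by blast
  qed
  have "complete_sieve Z W"
    unfolding complete_sieve_def Z
    using cover conv by (auto simp: W_def)
  then show ?thesis by blast
qed

lemma separable_metrizable_imp_second_countable:
  assumes "metrizable_space Z" and "separable_space Z"
  shows "second_countable Z"
proof -
  obtain M d where "Metric_space M d" and Z: "Z = Metric_space.mtopology M d"
    using assms(1) unfolding metrizable_space_def by blast
  interpret Metric_space M d by fact
  obtain C where C: "countable C" "C \<subseteq> M" "mtopology closure_of C = M"
    using assms(2) unfolding Z separable_space_def by auto
  let ?B = "(\<lambda>(c, n). mball c (1 / real (Suc n))) ` (C \<times> (UNIV :: nat set))"
  have "\<exists>V \<in> ?B. x \<in> V \<and> V \<subseteq> U" if U: "openin mtopology U" "x \<in> U" for U x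
  proof -
    obtain r where r: "r > 0" "mball x r \<subseteq> U"
      using U unfolding openin_mtopology by blast
    obtain n where n: "1 / real (Suc n) < r / 2"
      using reals_Archimedean[of "r/2"] r by (auto simp: field_simps)
    have x: "x \<in> M" using U openin_subset by fastforce
    then have "x \<in> mtopology closure_of C" using C by simp
    moreover have "1 / real (Suc n) > 0" by simp
    ultimately obtain c where c: "c \<in> C" "c \<in> mball x (1 / real (Suc n))"
      unfolding metric_closure_of by blast
    have "mball c (1 / real (Suc n)) \<subseteq> mball x r"
    proof
      fix y assume "y \<in> mball c (1 / real (Suc n))"
      then show "y \<in> mball x r"
        using c n x triangle[of x c y] by auto
    qed
    then show ?thesis
      using c r x by (intro bexI[of _ "mball c (1 / real (Suc n))"]) (auto simp: commute)
  qed
  then show ?thesis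
    unfolding second_countable_def Z using C(1)
    by (intro exI[of _ ?B]) auto
qed

section \<open>Separation of analytic sets\<close>

lemma sigma_algebra_borel_sets_of: "sigma_algebra (topspace T) (borel_sets_of T)"
  unfolding borel_sets_of_def by (rule sigma_algebra_sigma_sets) (auto dest: openin_subset)

lemma borel_sets_of_open: "openin T U \<Longrightarrow> U \<in> borel_sets_of T"
  unfolding borel_sets_of_def by (simp add: sigma_sets.Basic)

lemma borel_sets_of_subset: "B \<in> borel_sets_of T \<Longrightarrow> B \<subseteq> topspace T"
  unfolding borel_sets_of_def by (rule sigma_sets_into_sp) (auto dest: openin_subset)

lemma borel_sets_of_preimage:
  assumes f: "continuous_map S T f" and "B \<in> borel_sets_of T"
  shows "{x \<in> topspace S. f x \<in> B} \<in> borel_sets_of S"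
proof -
  interpret sigma_algebra "topspace S" "borel_sets_of S"
    by (rule sigma_algebra_borel_sets_of)
  have "B \<in> sigma_sets (topspace T) {U. openin T U}"
    using assms(2) by (simp add: borel_sets_of_def)
  then show ?thesis
  proof induction
    case (Basic U)
    then show ?case
      using openin_continuous_map_preimage[OF f] by (simp add: borel_sets_of_open)
  next
    case Empty
    show ?case by simp
  next
    case (Compl A)
    have "{x \<in> topspace S. f x \<in> topspace T - A} = topspace S - {x \<in> topspace S. f x \<in> A}"
      using f by (auto simp: continuous_map_def Pi_iff)
    then show ?case using Compl.IH compl_sets by simp
  next
    case (Union A)
    have "{x \<in> topspace S. f x \<in> (\<Union>i. A i)} = (\<Union>i. {x \<in> topspace S. f x \<in> A i})"
      by blast
    moreover have "(\<Union>i. {x \<in> topspace S. f x \<in> A i}) \<in> borel_sets_of S"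
      using Union.IH by (intro countable_UN) auto
    ultimately show ?case by simp
  qed
qed

text \<open>
  The asymmetric form of the definition loses nothing, as the complement of \<open>B\<close> is Borel too.
\<close>

definition borel_separable :: "'a topology \<Rightarrow> 'a set \<Rightarrow> 'a set \<Rightarrow> bool" where
  "borel_separable T X Y \<longleftrightarrow> (\<exists>B \<in> borel_sets_of T. X \<subseteq> B \<and> B \<inter> Y = {})"

text \<open>
  The union over \<open>n\<close> of the intersections over \<open>m\<close> of the separating sets separates the unions. Read
  backwards, this is the step of the tree argument for separation: if the unions cannot be
  separated, then some pair of pieces cannot be separated either.
\<close>

lemma borel_separable_Union:
  fixes X Y :: "nat \<Rightarrow> 'a set"
  assumes "\<And>n m. borel_separable T (X n) (Y m)"
  shows "borel_separable T (\<Union>n. X n) (\<Union>m. Y m)"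
proof -
  interpret sigma_algebra "topspace T" "borel_sets_of T"
    by (rule sigma_algebra_borel_sets_of)
  obtain B where B: "\<And>n m. B n m \<in> borel_sets_of T" "\<And>n m. X n \<subseteq> B n m"
      "\<And>n m. B n m \<inter> Y m = {}"
    using assms unfolding borel_separable_def by metis
  have "(\<Inter>m. B n m) \<in> borel_sets_of T" for n
    using B(1) by (intro countable_INT) auto
  then have "(\<Union>n. \<Inter>m. B n m) \<in> borel_sets_of T"
    by (intro countable_UN) auto
  moreover have "(\<Union>n. X n) \<subseteq> (\<Union>n. \<Inter>m. B n m)"
    by (rule UN_mono[OF order_refl], rule INT_greatest, rule B(2))
  moreover have "(\<Union>n. \<Inter>m. B n m) \<inter> (\<Union>m. Y m) = {}"
  proof -
    have False if "x \<in> (\<Inter>m. B n m)" "x \<in> Y m" for x n m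
      using that B(3)[of n m] by blast
    then show ?thesis by blast
  qed
  ultimately show ?thesis unfolding borel_separable_def by blast
qed

text \<open>
  The two sets are analytic, being continuous images of Polish spaces. If they could not be
  separated, one could pass to smaller and smaller cells \<open>V n\<close>, \<open>V' n\<close> of the domains whose images
  still cannot be separated. The cells converge to points \<open>z\<close>, \<open>z'\<close> with \<open>f z \<noteq> g z'\<close>, and disjoint
  open neighbourhoods of these values separate the images of late cells.
\<close>

theorem Lusin_separation:
  assumes T: "Hausdorff_space T"
    and Z: "completely_metrizable_space Z" "separable_space Z"
    and Z': "completely_metrizable_space Z'" "separable_space Z'"
    and f: "continuous_map Z T f" and g: "continuous_map Z' T g"
    and disj: "f ` topspace Z \<inter> g ` topspace Z' = {}"
  shows "borel_separable T (f ` topspace Z) (g ` topspace Z')"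
proof (rule ccontr)
  assume nsep: "\<not> borel_separable T (f ` topspace Z) (g ` topspace Z')"
  obtain W where W: "complete_sieve Z W"
    using separable_completely_metrizable_imp_complete_sieve[OF Z] by blast
  obtain W' where W': "complete_sieve Z' W'"
    using separable_completely_metrizable_imp_complete_sieve[OF Z'] by blast
  let ?P = "\<lambda>(n::nat) (V, V'). V \<subseteq> topspace Z \<and> V' \<subseteq> topspace Z'
     \<and> \<not> borel_separable T (f ` V) (g ` V') \<and> (n = 0 \<longrightarrow> V = topspace Z \<and> V' = topspace Z')"
  let ?Q = "\<lambda>n (V, V') (U, U'). (\<exists>i. U = V \<inter> W n i) \<and> (\<exists>i. U' = V' \<inter> W' n i)"
  have "\<exists>F. \<forall>n. ?P n (F n) \<and> ?Q n (F n) (F (Suc n))"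
  proof (rule dependent_nat_choice)
    show "\<exists>x. ?P 0 x"
      using nsep by (intro exI[of _ "(topspace Z, topspace Z')"]) auto
  next
    fix p and n :: nat assume p: "?P n p"
    obtain V V' where pV: "p = (V, V')" by fastforce
    have V: "V \<subseteq> topspace Z" "V' \<subseteq> topspace Z'" "\<not> borel_separable T (f ` V) (g ` V')"
      using p pV by auto
    have "f ` V = (\<Union>i. f ` (V \<inter> W n i))" "g ` V' = (\<Union>i. g ` (V' \<inter> W' n i))"
      by (rule complete_sieve_image_split[OF W V(1)], rule complete_sieve_image_split[OF W' V(2)])
    then obtain i j where "\<not> borel_separable T (f ` (V \<inter> W n i)) (g ` (V' \<inter> W' n j))"
      using V(3) borel_separable_Union by metis
    then show "\<exists>q. ?P (Suc n) q \<and> ?Q n p q"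
      using V(1,2) unfolding pV by (intro exI[of _ "(V \<inter> W n i, V' \<inter> W' n j)"]) auto
  qed
  then obtain F where F: "\<forall>n. ?P n (F n) \<and> ?Q n (F n) (F (Suc n))" by (rule exE)
  define V where "V n = fst (F n)" for n
  define V' where "V' n = snd (F n)" for n
  have V: "V n \<subseteq> topspace Z" "V' n \<subseteq> topspace Z'" "\<not> borel_separable T (f ` V n) (g ` V' n)"
    "V 0 = topspace Z" "V' 0 = topspace Z'"
    "\<exists>i. V (Suc n) = V n \<inter> W n i" "\<exists>i. V' (Suc n) = V' n \<inter> W' n i" for n
    using F[rule_format, of n] F[rule_format, of 0] by (simp_all add: V_def V'_def case_prod_beta)
  have empty_sep: "borel_separable T {} Y" "X \<subseteq> topspace T \<Longrightarrow> borel_separable T X {}" for X Y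
    unfolding borel_separable_def
    by (auto intro: borel_sets_of_open[OF openin_empty] borel_sets_of_open[OF openin_topspace])
  have fT: "f ` topspace Z \<subseteq> topspace T" and gT: "g ` topspace Z' \<subseteq> topspace T"
    using f g by (simp_all add: continuous_map_image_subset_topspace)
  have ne: "V n \<noteq> {}" "V' n \<noteq> {}" for n
  proof -
    have "f ` V n \<subseteq> topspace T" using fT V(1)[of n] by blast
    then show "V n \<noteq> {}" "V' n \<noteq> {}"
      using V(3)[of n] empty_sep(1)[of "g ` V' n"] empty_sep(2)[of "f ` V n"] by auto
  qed
  obtain z where z: "z \<in> topspace Z" "\<And>U. openin Z U \<Longrightarrow> z \<in> U \<Longrightarrow> \<exists>n. V n \<subseteq> U"
    using complete_sieve_converges[of Z W V] W V ne by metis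
  obtain z' where z': "z' \<in> topspace Z'" "\<And>U. openin Z' U \<Longrightarrow> z' \<in> U \<Longrightarrow> \<exists>n. V' n \<subseteq> U"
    using complete_sieve_converges[of Z' W' V'] W' V ne by metis
  have "f z \<noteq> g z'" using disj z(1) z'(1) by blast
  then obtain U U' where U: "openin T U" "openin T U'" "f z \<in> U" "g z' \<in> U'" "disjnt U U'"
    using T z(1) z'(1) fT gT unfolding Hausdorff_space_def by (metis image_subset_iff)
  obtain n where n: "V n \<subseteq> {x \<in> topspace Z. f x \<in> U}"
    using z(2)[OF openin_continuous_map_preimage[OF f U(1)]] z(1) U(3) by blast
  obtain m where m: "V' m \<subseteq> {x \<in> topspace Z'. g x \<in> U'}"
    using z'(2)[OF openin_continuous_map_preimage[OF g U(2)]] z'(1) U(4) by blast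
  have dec: "decseq V" "decseq V'"
    using V(6,7) by (auto intro!: decseq_SucI)
  define k where "k = max n m"
  have "f ` V k \<subseteq> U" "g ` V' k \<subseteq> U'"
    using n m decseqD[OF dec(1), of n k] decseqD[OF dec(2), of m k] unfolding k_def by auto
  then have "borel_separable T (f ` V k) (g ` V' k)"
    unfolding borel_separable_def using borel_sets_of_open[OF U(1)] U(5)
    by (intro bexI[of _ U]) (auto simp: disjnt_def)
  then show False using V(3) by blast
qed

section \<open>Nearly open maps\<close>

definition nearly_open_map :: "'a topology \<Rightarrow> 'b topology \<Rightarrow> ('a \<Rightarrow> 'b) \<Rightarrow> bool" where
  "nearly_open_map Z T f \<longleftrightarrow>
     (\<forall>V. openin Z V \<longrightarrow> f ` V \<subseteq> T interior_of (T closure_of (f ` V)))"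

text \<open>
  For open \<open>V\<close> let \<open>E V\<close> be the interior of the closure of the image of \<open>V\<close>. If \<open>V\<close> is covered by cells
  \<open>V \<inter> W n i\<close>, then near openness makes the union of the sets \<open>E (V \<inter> W n i)\<close> dense in \<open>E V\<close>. So apart from a meager
  set \<open>N\<close>, every point \<open>h\<close> of \<open>E (topspace Z)\<close> lies in \<open>E\<close> of all cells of some branch of the sieve.
  The branch converges to a point whose value is \<open>h\<close> by continuity.
\<close>

lemma nearly_open_imp_comeager_image:
  assumes T: "Hausdorff_space T"
    and Z: "completely_metrizable_space Z" "separable_space Z"
    and f: "continuous_map Z T f" and near: "nearly_open_map Z T f"
  shows "meager_in T (T interior_of (T closure_of (f ` topspace Z)) - f ` topspace Z)"
proof -
  obtain W where W: "complete_sieve Z W"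
    using separable_completely_metrizable_imp_complete_sieve[OF Z] by blast
  define E where "E V = T interior_of (T closure_of (f ` V))" for V
  have E_open: "openin T (E V)" for V
    unfolding E_def by (rule openin_interior_of)
  have E_cl: "E V \<subseteq> T closure_of (f ` V)" for V
    unfolding E_def by (rule interior_of_subset)
  have fT: "f ` V \<subseteq> topspace T" if "V \<subseteq> topspace Z" for V
    using f that continuous_map_image_subset_topspace by fastforce
  have step: "nowhere_dense_in T (E V - (\<Union>i. E (V \<inter> W n i)))" if V: "openin Z V" for V n
  proof -
    define R where "R = E V - (\<Union>i. E (V \<inter> W n i))"
    define U where "U = T interior_of (T closure_of R) \<inter> E V"
    have VW: "openin Z (V \<inter> W n i)" for i
      using V complete_sieve_open[OF W] by blast
    have "f ` V \<subseteq> (\<Union>i. E (V \<inter> W n i))"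
    proof -
      have "f ` V = (\<Union>i. f ` (V \<inter> W n i))"
        by (rule complete_sieve_image_split[OF W openin_subset[OF V]])
      also have "\<dots> \<subseteq> (\<Union>i. E (V \<inter> W n i))"
        using near VW unfolding nearly_open_map_def E_def by blast
      finally show ?thesis .
    qed
    moreover have opU: "openin T (\<Union>i. E (V \<inter> W n i))"
      using E_open by blast
    ultimately have "T closure_of R \<inter> f ` V = {}"
    proof -
      have "(\<Union>i. E (V \<inter> W n i)) \<inter> R = {}" unfolding R_def by blast
      then have "(\<Union>i. E (V \<inter> W n i)) \<inter> T closure_of R = {}"
        using openin_Int_closure_of_eq_empty[OF opU] by blast
      then show ?thesis using \<open>f ` V \<subseteq> _\<close> by blast
    qed
    then have "U \<inter> f ` V = {}"
      unfolding U_def using interior_of_subset by fastforce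
    moreover have openU: "openin T U" unfolding U_def by (intro openin_Int openin_interior_of E_open)
    ultimately have "U \<inter> T closure_of (f ` V) = {}"
      using openin_Int_closure_of_eq_empty by metis
    then have "U = {}" unfolding U_def using E_cl by blast
    moreover have "T interior_of (T closure_of R) \<inter> R \<subseteq> U"
      unfolding U_def R_def by blast
    ultimately have "T interior_of (T closure_of R) \<inter> T closure_of R = {}"
      using openin_Int_closure_of_eq_empty[OF openin_interior_of, of T "T closure_of R" R] by blast
    then have "T interior_of (T closure_of R) = {}"
      using interior_of_subset by fastforce
    moreover have "R \<subseteq> topspace T" unfolding R_def using E_open openin_subset by blast
    ultimately show ?thesis unfolding nowhere_dense_in_def R_def by blast
  qed
  \<comment> \<open>\<open>cell is\<close> is the intersection of the cells with indices \<open>is\<close>, listed from the deepest level up.\<close>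
  define cell where "cell = rec_list (topspace Z) (\<lambda>i is V. V \<inter> W (length is) i)"
  have cell: "cell [] = topspace Z" "cell (i # is) = cell is \<inter> W (length is) i" for i "is"
    unfolding cell_def by auto
  have cell_open: "openin Z (cell is)" for "is"
    by (induction "is") (auto simp: cell complete_sieve_open[OF W])
  define N where "N = (\<Union>is. E (cell is) - (\<Union>i. E (cell is \<inter> W (length is) i)))"
  have "meager_in T N"
    unfolding N_def using step[OF cell_open]
    by (intro meager_in_Union) (auto intro: nowhere_dense_imp_meager_in)
  moreover have "E (topspace Z) - f ` topspace Z \<subseteq> N"
  proof
    fix h assume h: "h \<in> E (topspace Z) - f ` topspace Z"
    show "h \<in> N"
    proof (rule ccontr)
      assume hN: "h \<notin> N"
      have "\<exists>s. \<forall>n. (length (s n) = n \<and> h \<in> E (cell (s n))) \<and> (\<exists>i. s (Suc n) = i # s n)"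
      proof (rule dependent_nat_choice)
        show "\<exists>is. length is = 0 \<and> h \<in> E (cell is)"
          using h cell by auto
        show "\<exists>y. (length y = Suc n \<and> h \<in> E (cell y)) \<and> (\<exists>i. y = i # x)"
          if "length x = n \<and> h \<in> E (cell x)" for x :: "nat list" and n
        proof -
          have "h \<in> (\<Union>i. E (cell x \<inter> W (length x) i))"
          proof (rule ccontr)
            assume "h \<notin> (\<Union>i. E (cell x \<inter> W (length x) i))"
            then have "h \<in> E (cell x) - (\<Union>i. E (cell x \<inter> W (length x) i))"
              using that by simp
            then have "h \<in> N" unfolding N_def by (rule UN_I[OF UNIV_I])
            then show False using hN by contradiction
          qed
          then obtain i where "h \<in> E (cell x \<inter> W (length x) i)" by (rule UN_E)
          then show ?thesis using that by (intro exI[of _ "i # x"]) (auto simp: cell)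
        qed
      qed
      then obtain s :: "nat \<Rightarrow> nat list" where s: "\<And>n. length (s n) = n" "\<And>n. h \<in> E (cell (s n))"
        "\<And>n. \<exists>i. s (Suc n) = i # s n" by metis
      define V where "V n = cell (s n)" for n
      have V0: "V 0 = topspace Z" unfolding V_def using s(1)[of 0] cell by simp
      have Vs: "\<exists>i. V (Suc n) = V n \<inter> W n i" for n
        unfolding V_def using s(1)[of n] s(3)[of n] cell(2) by metis
      have Vne: "V n \<noteq> {}" for n
        using s(2)[of n] unfolding V_def E_def by auto
      obtain z where z: "z \<in> topspace Z" "\<And>U. openin Z U \<Longrightarrow> z \<in> U \<Longrightarrow> \<exists>n. V n \<subseteq> U"
        using complete_sieve_converges[of Z W V] W V0 Vs Vne by metis
      have hT: "h \<in> topspace T" using h E_open openin_subset by blast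
      have "f z \<noteq> h" "f z \<in> topspace T" using h z(1) fT by blast+
      then obtain U U' where U: "openin T U" "openin T U'" "f z \<in> U" "h \<in> U'" "disjnt U U'"
        using T hT unfolding Hausdorff_space_def by metis
      obtain n where n: "V n \<subseteq> {x \<in> topspace Z. f x \<in> U}"
        using z(2)[OF openin_continuous_map_preimage[OF f U(1)]] z(1) U(3) by blast
      have "h \<in> T closure_of (f ` V n)" using s(2)[of n] E_cl unfolding V_def by blast
      then obtain y where "y \<in> f ` V n" "y \<in> U'"
        using U(2,4) unfolding in_closure_of by blast
      then show False using n U(5) unfolding disjnt_def by blast
    qed
  qed
  ultimately show ?thesis
    unfolding E_def by (rule meager_in_subset)
qed

section \<open>Polish groups\<close>

context polish_group
begin

lemma Hausdorff: "Hausdorff_space T"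
  by (simp add: completely_metrizable completely_metrizable_imp_metrizable_space
      metrizable_imp_Hausdorff_space)

lemma second_countable: "second_countable T"
  by (simp add: separable completely_metrizable completely_metrizable_imp_metrizable_space
      separable_metrizable_imp_second_countable)

lemma countable_subcover:
  assumes "\<And>U. U \<in> \<U> \<Longrightarrow> openin T U" and "\<Union>\<U> = topspace T"
  shows "\<exists>\<V>. countable \<V> \<and> \<V> \<subseteq> \<U> \<and> \<Union>\<V> = topspace T"
  by (rule Lindelof_spaceD[OF second_countable_imp_Lindelof_space[OF second_countable] assms])

lemma continuous_map_mult:
  assumes "continuous_map Z T f" and "continuous_map Z T g"
  shows "continuous_map Z T (\<lambda>x. f x \<otimes> g x)"
  using continuous_map_compose[OF continuous_map_pairedI[OF assms] continuous_mult]
  by (simp add: o_def)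

lemma continuous_map_inv:
  assumes "continuous_map Z T f"
  shows "continuous_map Z T (\<lambda>x. inv f x)"
  using continuous_map_compose[OF assms continuous_inv] by (simp add: o_def)

lemma continuous_map_left_translation: "g \<in> carrier G \<Longrightarrow> continuous_map T T (\<lambda>x. g \<otimes> x)"
  by (intro continuous_map_mult) (simp_all add: topspace_eq)

lemma homeomorphic_map_left_translation:
  assumes "g \<in> carrier G"
  shows "homeomorphic_map T T (\<lambda>x. g \<otimes> x)"
proof -
  have "homeomorphic_maps T T (\<lambda>x. g \<otimes> x) (\<lambda>x. inv g \<otimes> x)"
    unfolding homeomorphic_maps_def using assms
    by (simp add: continuous_map_left_translation topspace_eq m_assoc[symmetric])
  then show ?thesis by (rule homeomorphic_maps_imp_map)
qed

lemma l_coset_eq_image: "g <# X = (\<lambda>x. g \<otimes> x) ` X"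
  unfolding l_coset_def by blast

lemma openin_l_coset: "g \<in> carrier G \<Longrightarrow> openin T X \<Longrightarrow> openin T (g <# X)"
  unfolding l_coset_eq_image
  using homeomorphic_map_openness[OF homeomorphic_map_left_translation] openin_subset by blast

lemma meager_in_l_coset: "g \<in> carrier G \<Longrightarrow> meager_in T X \<Longrightarrow> meager_in T (g <# X)"
  unfolding l_coset_eq_image
  by (rule meager_in_homeomorphic_image[OF homeomorphic_map_left_translation])

lemma borel_sets_of_l_coset:
  assumes "g \<in> carrier G" and "B \<in> borel_sets_of T"
  shows "g <# B \<in> borel_sets_of T"
proof -
  have "g <# B = {x \<in> topspace T. inv g \<otimes> x \<in> B}"
  proof (intro equalityI subsetI)
    fix x assume "x \<in> g <# B"
    then obtain b where "b \<in> B" "x = g \<otimes> b" unfolding l_coset_def by blast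
    moreover have "b \<in> carrier G"
      using \<open>b \<in> B\<close> borel_sets_of_subset[OF assms(2)] topspace_eq by blast
    ultimately show "x \<in> {x \<in> topspace T. inv g \<otimes> x \<in> B}"
      using assms(1) by (simp add: topspace_eq m_assoc[symmetric])
  next
    fix x assume "x \<in> {x \<in> topspace T. inv g \<otimes> x \<in> B}"
    then have x: "x \<in> carrier G" "inv g \<otimes> x \<in> B" by (auto simp: topspace_eq)
    then have "x = g \<otimes> (inv g \<otimes> x)" using assms(1) by (simp add: m_assoc[symmetric])
    then show "x \<in> g <# B" unfolding l_coset_def using x(2) by blast
  qed
  then show ?thesis
    using borel_sets_of_preimage[OF continuous_map_left_translation assms(2), of "inv g"] assms(1)
    by simp
qed

lemma subgroup_openI:
  assumes P: "subgroup P G" and W: "openin T W" "\<one> \<in> W" "W \<subseteq> P"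
  shows "openin T P"
proof -
  have "P = (\<Union>p\<in>P. p <# W)"
  proof (intro equalityI subsetI)
    fix x assume "x \<in> P"
    then have "x \<in> x <# W"
      unfolding l_coset_def using W(2) subgroup.mem_carrier[OF P] by force
    then show "x \<in> (\<Union>p\<in>P. p <# W)" using \<open>x \<in> P\<close> by blast
  next
    fix x assume "x \<in> (\<Union>p\<in>P. p <# W)"
    then show "x \<in> P"
      unfolding l_coset_def using W(3) subgroup.m_closed[OF P] by blast
  qed
  moreover have "openin T (\<Union>p\<in>P. p <# W)"
    using openin_l_coset[OF subgroup.mem_carrier[OF P] W(1)] by (intro openin_Union) auto
  ultimately show ?thesis by simp
qed

text \<open>
  For \<open>h \<in> W\<close> the sets \<open>P\<close> and \<open>h P\<close> are both comeager in the open set \<open>W \<inter> h W\<close>, which is nonempty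
  because it contains \<open>h\<close>. By Baire they meet, which puts \<open>h\<close> into \<open>P\<close>.
\<close>

lemma subgroup_openI_comeager:
  assumes P: "subgroup P G" and W: "openin T W" "\<one> \<in> W" and cm: "meager_in T (W - P)"
  shows "openin T P"
proof -
  have "W \<subseteq> P"
  proof (rule ccontr)
    assume "\<not> W \<subseteq> P"
    then obtain h where h: "h \<in> W" "h \<notin> P" by blast
    have hG: "h \<in> carrier G" using h(1) openin_subset[OF W(1)] topspace_eq by blast
    have "P \<inter> (h <# P) = {}"
    proof -
      have False if "h \<otimes> p \<in> P" "p \<in> P" for p
      proof -
        have "(h \<otimes> p) \<otimes> inv p \<in> P"
          using that subgroup.m_closed[OF P] subgroup.m_inv_closed[OF P] by blast
        then show False
          using h(2) hG subgroup.mem_carrier[OF P that(2)] by (simp add: m_assoc)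
      qed
      then show ?thesis unfolding l_coset_def by blast
    qed
    then have "W \<inter> (h <# W) \<subseteq> (W - P) \<union> (h <# (W - P))"
      unfolding l_coset_def by blast
    then have "meager_in T (W \<inter> (h <# W))"
      using meager_in_subset meager_in_Un[OF cm meager_in_l_coset[OF hG cm]] by blast
    moreover have "openin T (W \<inter> (h <# W))"
      using W(1) openin_l_coset[OF hG] by blast
    moreover have "h \<in> W \<inter> (h <# W)"
      using h(1) W(2) hG unfolding l_coset_def by force
    ultimately show False
      using not_meager_in_open[OF completely_metrizable] by blast
  qed
  then show ?thesis by (rule subgroup_openI[OF P W])
qed

text \<open>
  Countably many translates of \<open>U\<close> cover the group, and they cannot all be null for a probability
  measure.
\<close>

lemma open_not_Haar_null:
  assumes U: "openin T U" "U \<noteq> {}"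
  shows "U \<notin> Haar_ideal G T"
proof
  assume "U \<in> Haar_ideal G T"
  then obtain B \<mu> where B: "U \<subseteq> B" "B \<in> borel_sets_of T" and \<mu>: "borel_prob_measure T \<mu>"
    and null: "\<And>g h. g \<in> carrier G \<Longrightarrow> h \<in> carrier G \<Longrightarrow> emeasure \<mu> ((g <# B) #> h) = 0"
    unfolding Haar_ideal_def Haar_null_Borel_def by blast
  interpret prob_space \<mu> using \<mu> unfolding borel_prob_measure_def by blast
  have sets_\<mu>: "sets \<mu> = borel_sets_of T" using \<mu> unfolding borel_prob_measure_def by blast
  have space_\<mu>: "space \<mu> = topspace T"
    using sets_eq_imp_space_eq[of \<mu> "sigma (topspace T) {U. openin T U}"] sets_\<mu>
    by (simp add: borel_sets_of_def space_measure_of sets_measure_of Collect_mono openin_subset subsetI Pow_def)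
  obtain u where u: "u \<in> U" using U(2) by blast
  have UG: "U \<subseteq> carrier G" using openin_subset[OF U(1)] topspace_eq by simp
  let ?\<U> = "(\<lambda>g. g <# U) ` carrier G"
  have \<U>_open: "openin T V" if "V \<in> ?\<U>" for V
    using that openin_l_coset[OF _ U(1)] by blast
  have "\<Union>?\<U> = topspace T"
  proof
    show "\<Union>?\<U> \<subseteq> topspace T"
      using openin_subset[OF openin_l_coset[OF _ U(1)]] by blast
    show "topspace T \<subseteq> \<Union>?\<U>"
    proof
      fix x assume "x \<in> topspace T"
      then have x: "x \<in> carrier G" by (simp add: topspace_eq)
      then have "x = (x \<otimes> inv u) \<otimes> u" using u UG by (simp add: m_assoc subset_iff)
      moreover have "x \<otimes> inv u \<in> carrier G" using x u UG by blast
      ultimately show "x \<in> \<Union>?\<U>" using u unfolding l_coset_def by blast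
    qed
  qed
  with \<U>_open have "\<exists>\<V>. countable \<V> \<and> \<V> \<subseteq> ?\<U> \<and> \<Union>\<V> = topspace T"
    by (rule countable_subcover)
  then obtain \<V> where \<V>: "countable \<V>" "\<V> \<subseteq> ?\<U>" "\<Union>\<V> = topspace T"
    by (elim exE conjE)
  have "\<exists>N \<in> null_sets \<mu>. V \<subseteq> N" if V: "V \<in> \<V>" for V
  proof -
    obtain g where g: "g \<in> carrier G" "V = g <# U"
      using subsetD[OF \<V>(2) V] by blast
    have gB: "g <# B \<in> sets \<mu>" using borel_sets_of_l_coset[OF g(1) B(2)] sets_\<mu> by simp
    then have "g <# B \<subseteq> carrier G" using sets.sets_into_space[OF gB] space_\<mu> topspace_eq by simp
    then have "(g <# B) #> \<one> = g <# B" by (rule coset_mult_one)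
    then have "g <# B \<in> null_sets \<mu>" using null[OF g(1) one_closed] gB by auto
    moreover have "V \<subseteq> g <# B" using g(2) B(1) unfolding l_coset_eq_image by (simp add: image_mono)
    ultimately show ?thesis by (rule bexI[rotated])
  qed
  then obtain N where N: "\<And>V. V \<in> \<V> \<Longrightarrow> N V \<in> null_sets \<mu>" "\<And>V. V \<in> \<V> \<Longrightarrow> V \<subseteq> N V"
    by metis
  have "(\<Union>V\<in>\<V>. N V) \<in> null_sets \<mu>" using N(1) \<V>(1) by (intro null_sets_UN') auto
  moreover have "space \<mu> \<subseteq> (\<Union>V\<in>\<V>. N V)" using N(2) \<V>(3) space_\<mu> by blast
  ultimately have "space \<mu> \<in> null_sets \<mu>"
    using null_sets_subset sets.top by metis
  then have "emeasure \<mu> (space \<mu>) = 0" by (rule null_setsD1)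
  then show False using emeasure_space_1 by simp
qed

end

lemma polish_group_closed_subgroup:
  fixes G (structure)
  assumes "polish_group G T" and P: "subgroup P G" and cl: "closedin T P"
  shows "polish_group (G\<lparr>carrier := P\<rparr>) (subtopology T P)"
proof -
  interpret polish_group G T by fact
  have sub: "P \<subseteq> carrier G" by (rule subgroup.subset[OF P])
  interpret P: group "G\<lparr>carrier := P\<rparr>" by (rule subgroup_imp_group[OF P])
  show ?thesis
  proof
    show top: "topspace (subtopology T P) = carrier (G\<lparr>carrier := P\<rparr>)"
      using sub topspace_eq by auto
    show "separable_space (subtopology T P)"
      by (intro second_countable_imp_separable_space second_countable_subtopology second_countable)
    show "completely_metrizable_space (subtopology T P)"
      by (rule completely_metrizable_space_closedin[OF completely_metrizable cl])
    have id: "continuous_map (subtopology T P) T (\<lambda>x. x)"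
      by (rule continuous_map_from_subtopology[OF continuous_map_id[unfolded id_def]])
    have "continuous_map (prod_topology (subtopology T P) (subtopology T P)) T (\<lambda>z. fst z \<otimes> snd z)"
      by (intro continuous_map_mult continuous_map_compose[OF continuous_map_fst id, unfolded o_def]
          continuous_map_compose[OF continuous_map_snd id, unfolded o_def])
    moreover have "(\<lambda>z. fst z \<otimes> snd z) \<in>
        topspace (prod_topology (subtopology T P) (subtopology T P)) \<rightarrow> P"
      using subgroup.m_closed[OF P] by auto
    ultimately show "continuous_map (prod_topology (subtopology T P) (subtopology T P)) (subtopology T P)
        (\<lambda>(x, y). x \<otimes>\<^bsub>G\<lparr>carrier := P\<rparr>\<^esub> y)"
      using continuous_map_into_subtopology by (fastforce simp: case_prod_beta')
    have "continuous_map (subtopology T P) (subtopology T P) (\<lambda>x. inv x)"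
      using subgroup.m_inv_closed[OF P]
      by (intro continuous_map_into_subtopology continuous_map_inv id) auto
    then show "continuous_map (subtopology T P) (subtopology T P) (\<lambda>x. inv\<^bsub>G\<lparr>carrier := P\<rparr>\<^esub> x)"
      by (rule continuous_map_eq) (use m_inv_consistent[OF P] in auto)
  qed
qed

lemma polish_group_DirProd:
  assumes "polish_group G S" and "polish_group H T"
  shows "polish_group (G \<times>\<times> H) (prod_topology S T)"
proof -
  interpret G: polish_group G S by fact
  interpret H: polish_group H T by fact
  interpret GH: group "G \<times>\<times> H" by (rule DirProd_group) unfold_locales
  let ?K = "prod_topology S T"
  show ?thesis
  proof
    show "topspace ?K = carrier (G \<times>\<times> H)"
      by (simp add: G.topspace_eq H.topspace_eq)
    obtain C where C: "countable C" "C \<subseteq> topspace S" "S closure_of C = topspace S"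
      using G.separable unfolding separable_space_def by blast
    obtain D where D: "countable D" "D \<subseteq> topspace T" "T closure_of D = topspace T"
      using H.separable unfolding separable_space_def by blast
    show "separable_space ?K"
      unfolding separable_space_def using C D
      by (intro exI[of _ "C \<times> D"]) (auto simp: closure_of_Times)
    show "completely_metrizable_space ?K"
      by (simp add: completely_metrizable_space_prod_topology G.completely_metrizable H.completely_metrizable)
    have fst: "continuous_map (prod_topology ?K ?K) S (\<lambda>z. fst (fst z))"
        "continuous_map (prod_topology ?K ?K) S (\<lambda>z. fst (snd z))"
      and snd: "continuous_map (prod_topology ?K ?K) T (\<lambda>z. snd (fst z))"
        "continuous_map (prod_topology ?K ?K) T (\<lambda>z. snd (snd z))"
      by (intro continuous_map_compose[OF continuous_map_fst continuous_map_fst, unfolded o_def]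
          continuous_map_compose[OF continuous_map_snd continuous_map_fst, unfolded o_def]
          continuous_map_compose[OF continuous_map_fst continuous_map_snd, unfolded o_def]
          continuous_map_compose[OF continuous_map_snd continuous_map_snd, unfolded o_def])+
    have "continuous_map (prod_topology ?K ?K) ?K
        (\<lambda>z. (fst (fst z) \<otimes>\<^bsub>G\<^esub> fst (snd z), snd (fst z) \<otimes>\<^bsub>H\<^esub> snd (snd z)))"
      by (intro continuous_map_pairedI G.continuous_map_mult H.continuous_map_mult fst snd)
    then show "continuous_map (prod_topology ?K ?K) ?K (\<lambda>(x, y). x \<otimes>\<^bsub>G \<times>\<times> H\<^esub> y)"
      by (simp add: case_prod_beta' mult_DirProd')
    have "continuous_map ?K ?K (\<lambda>z. (inv\<^bsub>G\<^esub> fst z, inv\<^bsub>H\<^esub> snd z))"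
      by (intro continuous_map_pairedI G.continuous_map_inv H.continuous_map_inv
          continuous_map_fst continuous_map_snd)
    then show "continuous_map ?K ?K (\<lambda>x. inv\<^bsub>G \<times>\<times> H\<^esub> x)"
    proof (rule continuous_map_eq)
      fix x assume "x \<in> topspace ?K"
      then show "(inv\<^bsub>G\<^esub> fst x, inv\<^bsub>H\<^esub> snd x) = inv\<^bsub>G \<times>\<times> H\<^esub> x"
        using inv_DirProd[OF G.group_axioms H.group_axioms, of "fst x" "snd x"]
        by (auto simp: G.topspace_eq H.topspace_eq)
    qed
  qed
qed

text \<open>
  Fix \<open>k \<in> V\<close>. Countably many open sets \<open>N\<close> with \<open>k N\<^sup>-\<^sup>1 N \<subseteq> V\<close> cover the domain, so the image of one of
  them is not nowhere dense, and the interior of the closure of this image contains some \<open>f v\<close> with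
  \<open>v \<in> N\<close>. Translation by \<open>f (k v\<^sup>-\<^sup>1)\<close> moves \<open>f v\<close> to \<open>f k\<close> and \<open>f N\<close> into \<open>f V\<close>.
\<close>

lemma nonmeager_hom_nearly_open:
  assumes "polish_group K S" and "polish_group H T"
    and hom: "f \<in> hom K H" and f: "continuous_map S T f"
    and nm: "\<not> meager_in T (f ` carrier K)"
  shows "nearly_open_map S T f"
  unfolding nearly_open_map_def
proof (intro allI impI subsetI)
  interpret K: polish_group K S by fact
  interpret H: polish_group H T by fact
  interpret f: group_hom K H f using hom by unfold_locales
  fix V y assume V: "openin S V" and "y \<in> f ` V"
  then obtain k where k: "k \<in> V" "y = f k" by blast
  have kK: "k \<in> carrier K" using openin_subset[OF V] k(1) K.topspace_eq by blast
  let ?m = "\<lambda>z. k \<otimes>\<^bsub>K\<^esub> (inv\<^bsub>K\<^esub> fst z \<otimes>\<^bsub>K\<^esub> snd z)"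
  have m: "continuous_map (prod_topology S S) S ?m"
    using kK by (intro K.continuous_map_mult K.continuous_map_inv continuous_map_fst continuous_map_snd)
      (simp add: K.topspace_eq)
  define \<U> where "\<U> = {N. openin S N \<and> (\<forall>a\<in>N. \<forall>b\<in>N. k \<otimes>\<^bsub>K\<^esub> (inv\<^bsub>K\<^esub> a \<otimes>\<^bsub>K\<^esub> b) \<in> V)}"
  have \<U>_open: "openin S N" if "N \<in> \<U>" for N
    using that unfolding \<U>_def by blast
  have "\<Union>\<U> = topspace S"
  proof
    show "\<Union>\<U> \<subseteq> topspace S" unfolding \<U>_def using openin_subset by blast
    show "topspace S \<subseteq> \<Union>\<U>"
    proof
      fix x assume x: "x \<in> topspace S"
      let ?O = "{z \<in> topspace (prod_topology S S). ?m z \<in> V}"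
      have "openin (prod_topology S S) ?O" by (rule openin_continuous_map_preimage[OF m V])
      moreover have "(x, x) \<in> ?O" using x kK k(1) by (simp add: K.topspace_eq)
      ultimately obtain A B where AB: "openin S A" "openin S B" "x \<in> A" "x \<in> B" "A \<times> B \<subseteq> ?O"
        unfolding openin_prod_topology_alt by meson
      then have "A \<inter> B \<in> \<U>" unfolding \<U>_def by auto
      then show "x \<in> \<Union>\<U>" using AB by blast
    qed
  qed
  with \<U>_open have "\<exists>\<V>. countable \<V> \<and> \<V> \<subseteq> \<U> \<and> \<Union>\<V> = topspace S"
    by (rule K.countable_subcover)
  then obtain \<V> where \<V>: "countable \<V>" "\<V> \<subseteq> \<U>" "\<Union>\<V> = topspace S"
    by (elim exE conjE)
  have "\<exists>N\<in>\<V>. \<not> meager_in T (f ` N)"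
  proof (rule ccontr)
    assume "\<not> ?thesis"
    then have "meager_in T (\<Union>((\<lambda>N. f ` N) ` \<V>))"
      using \<V>(1) by (intro meager_in_Union) auto
    moreover have "f ` carrier K = \<Union>((\<lambda>N. f ` N) ` \<V>)"
      using \<V>(3) K.topspace_eq by blast
    ultimately show False using nm by simp
  qed
  then obtain N where N: "N \<in> \<U>" "\<not> meager_in T (f ` N)" using \<V>(2) by blast
  have NK: "N \<subseteq> carrier K" using N(1) openin_subset K.topspace_eq unfolding \<U>_def by blast
  define R where "R = T interior_of (T closure_of (f ` N))"
  have "f ` N \<subseteq> topspace T" using NK f.hom_closed H.topspace_eq by blast
  then have "R \<noteq> {}"
    using N(2) nowhere_dense_imp_meager_in unfolding R_def nowhere_dense_in_def by blast
  moreover have R: "openin T R" "R \<subseteq> T closure_of (f ` N)"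
    unfolding R_def by (rule openin_interior_of, rule interior_of_subset)
  ultimately obtain v where v: "v \<in> N" "f v \<in> R"
    using openin_Int_closure_of_eq_empty[OF R(1), of "f ` N"] by blast
  have vK: "v \<in> carrier K" using v NK by blast
  define c where "c = f (k \<otimes>\<^bsub>K\<^esub> inv\<^bsub>K\<^esub> v)"
  have c: "c \<in> carrier H" unfolding c_def using kK vK by simp
  have "c <#\<^bsub>H\<^esub> R \<subseteq> c <#\<^bsub>H\<^esub> (T closure_of (f ` N))"
    using R(2) unfolding l_coset_def by blast
  also have "\<dots> = T closure_of (c <#\<^bsub>H\<^esub> (f ` N))"
    unfolding H.l_coset_eq_image
    by (rule homeomorphic_map_closure_of[OF H.homeomorphic_map_left_translation[OF c], symmetric]) fact
  also have "\<dots> \<subseteq> T closure_of (f ` V)"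
  proof (rule closure_of_mono, rule subsetI)
    fix y assume "y \<in> c <#\<^bsub>H\<^esub> (f ` N)"
    then obtain b where b: "b \<in> N" "y = c \<otimes>\<^bsub>H\<^esub> f b" unfolding l_coset_def by blast
    have "k \<otimes>\<^bsub>K\<^esub> (inv\<^bsub>K\<^esub> v \<otimes>\<^bsub>K\<^esub> b) \<in> V" using N(1) v(1) b(1) unfolding \<U>_def by blast
    moreover have "y = f (k \<otimes>\<^bsub>K\<^esub> (inv\<^bsub>K\<^esub> v \<otimes>\<^bsub>K\<^esub> b))"
      using kK vK b NK unfolding c_def by (simp add: subset_iff H.m_assoc)
    ultimately show "y \<in> f ` V" by blast
  qed
  finally have "c <#\<^bsub>H\<^esub> R \<subseteq> T interior_of (T closure_of (f ` V))"
    by (rule interior_of_maximal[OF _ H.openin_l_coset[OF c R(1)]])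
  moreover have "y \<in> c <#\<^bsub>H\<^esub> R"
  proof -
    have "y = c \<otimes>\<^bsub>H\<^esub> f v" using kK vK k(2) unfolding c_def by (simp add: H.m_assoc)
    then show ?thesis using v(2) unfolding l_coset_def by blast
  qed
  ultimately show "y \<in> T interior_of (T closure_of (f ` V))" by blast
qed

text \<open>
  Near openness makes the image comeager in the interior of its closure, an open set containing the
  identity, and a subgroup that is comeager in such a set is open.
\<close>

theorem nonmeager_hom_image_open:
  assumes K: "polish_group K S" and H: "polish_group H T"
    and hom: "f \<in> hom K H" and f: "continuous_map S T f"
    and nm: "\<not> meager_in T (f ` carrier K)"
  shows "openin T (f ` carrier K)"
proof -
  interpret K: polish_group K S by fact
  interpret H: polish_group H T by fact
  interpret f: group_hom K H f using hom by unfold_locales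
  have near: "nearly_open_map S T f" by (rule nonmeager_hom_nearly_open[OF assms])
  let ?W = "T interior_of (T closure_of (f ` carrier K))"
  show ?thesis
  proof (rule H.subgroup_openI_comeager)
    show "subgroup (f ` carrier K) H" by (rule f.img_is_subgroup)
    show "openin T ?W" by (rule openin_interior_of)
    have "f ` carrier K \<subseteq> ?W"
      using near openin_topspace[of S] K.topspace_eq unfolding nearly_open_map_def by metis
    moreover have "\<one>\<^bsub>H\<^esub> \<in> f ` carrier K"
      by (rule image_eqI[of _ _ "\<one>\<^bsub>K\<^esub>"]) auto
    ultimately show "\<one>\<^bsub>H\<^esub> \<in> ?W" by blast
    show "meager_in T (?W - f ` carrier K)"
      using nearly_open_imp_comeager_image[OF H.Hausdorff K.completely_metrizable K.separable f near]
        K.topspace_eq by simp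
  qed
qed

section \<open>Coin tossing\<close>

definition coin_space :: "(nat \<Rightarrow> bool) measure" where
  "coin_space = PiM UNIV (\<lambda>_. uniform_count_measure UNIV)"

definition flip :: "nat \<Rightarrow> (nat \<Rightarrow> bool) \<Rightarrow> nat \<Rightarrow> bool" where
  "flip n \<omega> = (\<lambda>k. if k = n then \<not> \<omega> n else \<omega> k)"

lemma space_coin_space [simp]: "space coin_space = UNIV"
  by (auto simp: coin_space_def space_PiM space_uniform_count_measure)

lemma prob_space_coin_space: "prob_space coin_space"
  unfolding coin_space_def by (intro prob_space_PiM prob_space_uniform_count_measure) auto

lemma coin_in_sets: "{\<omega>. \<omega> n} \<in> sets coin_space" "{\<omega>. \<not> \<omega> n} \<in> sets coin_space"
proof -
  have "(\<lambda>\<omega>. \<omega> n) \<in> measurable coin_space (uniform_count_measure (UNIV :: bool set))"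
    unfolding coin_space_def by (rule measurable_component_singleton) simp
  from measurable_sets[OF this, of "{True}"] measurable_sets[OF this, of "{False}"]
  show "{\<omega>. \<omega> n} \<in> sets coin_space" "{\<omega>. \<not> \<omega> n} \<in> sets coin_space"
    by (auto simp: vimage_def sets_uniform_count_measure)
qed

lemma flip_measurable: "flip n \<in> measurable coin_space coin_space"
proof -
  have "(\<lambda>\<omega> i. if i = n then \<not> \<omega> n else \<omega> i) \<in> measurable coin_space coin_space"
    unfolding coin_space_def
  proof (rule measurable_PiM_single')
    fix i :: nat
    have comp: "(\<lambda>\<omega>. \<omega> i) \<in> measurable (PiM UNIV (\<lambda>_. uniform_count_measure UNIV))
        (uniform_count_measure (UNIV :: bool set))"
      by (rule measurable_component_singleton) simp
    have "Not \<in> measurable (uniform_count_measure UNIV) (uniform_count_measure (UNIV :: bool set))"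
      by (auto simp: measurable_def space_uniform_count_measure sets_uniform_count_measure)
    from measurable_compose[OF comp this] comp
    show "(\<lambda>\<omega>. if i = n then \<not> \<omega> n else \<omega> i) \<in> measurable (PiM UNIV (\<lambda>_. uniform_count_measure UNIV))
        (uniform_count_measure UNIV)"
      by (cases "i = n") auto
  qed (auto simp: space_uniform_count_measure)
  moreover have "flip n = (\<lambda>\<omega> i. if i = n then \<not> \<omega> n else \<omega> i)"
    by (auto simp: flip_def fun_eq_iff)
  ultimately show ?thesis by simp
qed

text \<open>
  It suffices to compare cylinders, and a flip only complements one factor of a cylinder.
\<close>

lemma distr_flip: "distr coin_space coin_space (flip n) = coin_space"
proof -
  interpret product_prob_space "\<lambda>_ :: nat. uniform_count_measure (UNIV :: bool set)" UNIV
    by (intro product_prob_spaceI prob_space_uniform_count_measure) auto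
  let ?M = "\<lambda>_ :: nat. uniform_count_measure (UNIV :: bool set)"
  have Not: "emeasure (uniform_count_measure UNIV) (Not -` A) =
      emeasure (uniform_count_measure UNIV) A" for A :: "bool set"
  proof -
    have "bij_betw Not (Not -` A) A" by (rule bij_betwI[where g = Not]) auto
    then show ?thesis by (simp add: emeasure_uniform_count_measure bij_betw_same_card)
  qed
  have "distr coin_space coin_space (flip n) = PiM UNIV ?M"
  proof (rule PiM_eq)
    show "sets (distr coin_space coin_space (flip n)) = sets (PiM UNIV ?M)"
      by (simp add: coin_space_def)
    fix J :: "nat set" and F :: "nat \<Rightarrow> bool set"
    assume J: "finite J"
    have Fs: "F j \<in> sets (?M j)" for F :: "nat \<Rightarrow> bool set" and j
      by (simp add: sets_uniform_count_measure)
    let ?F' = "\<lambda>j. if j = n then Not -` F j else F j"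
    have cyl: "prod_emb UNIV ?M J (\<Pi>\<^sub>E j\<in>J. F j) = {\<omega>. \<forall>j\<in>J. \<omega> j \<in> F j}" for F :: "nat \<Rightarrow> bool set"
      by (auto simp: prod_emb_def space_uniform_count_measure restrict_PiE_iff)
    have "prod_emb UNIV ?M J (\<Pi>\<^sub>E j\<in>J. F j) \<in> sets coin_space"
      unfolding coin_space_def by (intro sets_PiM_I J Fs) auto
    then have "emeasure (distr coin_space coin_space (flip n)) (prod_emb UNIV ?M J (\<Pi>\<^sub>E j\<in>J. F j))
        = emeasure coin_space (flip n -` {\<omega>. \<forall>j\<in>J. \<omega> j \<in> F j})"
      by (simp add: emeasure_distr flip_measurable cyl)
    also have "flip n -` {\<omega>. \<forall>j\<in>J. \<omega> j \<in> F j} = prod_emb UNIV ?M J (\<Pi>\<^sub>E j\<in>J. ?F' j)"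
      unfolding cyl by (auto simp: flip_def)
    also have "emeasure coin_space \<dots> = (\<Prod>j\<in>J. emeasure (?M j) (?F' j))"
      unfolding coin_space_def using J Fs by (intro emeasure_PiM_emb) auto
    also have "\<dots> = (\<Prod>j\<in>J. emeasure (?M j) (F j))"
      by (intro prod.cong refl) (simp add: Not)
    finally show "emeasure (distr coin_space coin_space (flip n)) (prod_emb UNIV ?M J (\<Pi>\<^sub>E j\<in>J. F j))
        = (\<Prod>j\<in>J. emeasure (?M j) (F j))" .
  qed
  then show ?thesis by (simp add: coin_space_def)
qed

text \<open>
  The preimages of \<open>Q\<close> under the flips all have the probability of \<open>Q\<close>, so infinitely many disjoint
  ones leave only probability \<open>0\<close>.
\<close>

lemma disjoint_flips_imp_null:
  assumes Q: "Q \<in> sets coin_space" and disj: "disjoint_family (\<lambda>n. flip n -` Q)"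
  shows "emeasure coin_space Q = 0"
proof -
  interpret prob_space coin_space by (rule prob_space_coin_space)
  have sets: "flip n -` Q \<in> sets coin_space" for n
    using measurable_sets[OF flip_measurable Q] by simp
  have "measure coin_space (flip n -` Q) = measure coin_space Q" for n
    using measure_distr[OF flip_measurable Q, of n] by (simp add: distr_flip)
  then have "(\<lambda>n :: nat. measure coin_space Q) sums measure coin_space (\<Union>n. flip n -` Q)"
    using finite_measure_UNION[OF _ disj] sets by (simp add: image_subset_iff)
  then have "measure coin_space Q = 0"
    using sums_summable summable_const_iff by blast
  then show ?thesis by (simp add: emeasure_eq_measure)
qed

section \<open>Meager analytic subgroups of abelian Polish groups\<close>

locale abelian_polish_group = polish_group G T + comm_group G for G (structure) and T
begin

primrec partial_product :: "(nat \<Rightarrow> 'a) \<Rightarrow> nat \<Rightarrow> (nat \<Rightarrow> bool) \<Rightarrow> 'a" where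
  "partial_product g 0 \<omega> = \<one>"
| "partial_product g (Suc n) \<omega> = partial_product g n \<omega> \<otimes> (if \<omega> n then g n else \<one>)"

lemma partial_product_cong:
  "(\<And>k. k < n \<Longrightarrow> f k = g k) \<Longrightarrow> partial_product f n \<omega> = partial_product g n \<omega>"
  by (induction n) auto

lemma partial_product_closed:
  "(\<And>k. k < n \<Longrightarrow> g k \<in> carrier G) \<Longrightarrow> partial_product g n \<omega> \<in> carrier G"
  by (induction n) auto

lemma finite_range_partial_product: "finite (range (partial_product g n))"
proof (induction n)
  case (Suc n)
  have "range (partial_product g (Suc n)) \<subseteq>
      (\<lambda>(x, b). x \<otimes> (if b then g n else \<one>)) ` (range (partial_product g n) \<times> UNIV)"
    by auto
  then show ?case by (rule finite_subset) (simp add: Suc)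
qed simp

lemma partial_product_measurable: "{\<omega>. R (partial_product g n \<omega>)} \<in> sets coin_space"
proof (induction n arbitrary: R)
  case 0
  show ?case using sets.top[of coin_space] by (cases "R \<one>") auto
next
  case (Suc n)
  have "{\<omega>. R (partial_product g (Suc n) \<omega>)} =
      ({\<omega>. \<omega> n} \<inter> {\<omega>. R (partial_product g n \<omega> \<otimes> g n)}) \<union>
      ({\<omega>. \<not> \<omega> n} \<inter> {\<omega>. R (partial_product g n \<omega> \<otimes> \<one>)})"
    by auto
  then show ?case
    using Suc.IH[of "\<lambda>x. R (x \<otimes> g n)"] Suc.IH[of "\<lambda>x. R (x \<otimes> \<one>)"] coin_in_sets[of n] by auto
qed

text \<open>
  This is where the random product needs a commutative group: the changed factor sits in the middle
  of the product.
\<close>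

lemma partial_product_flip:
  assumes g: "\<And>k. g k \<in> carrier G" and "n < N"
  shows "partial_product g N (flip n \<omega>) =
    partial_product g N \<omega> \<otimes> (if \<omega> n then inv g n else g n)"
proof -
  have below: "partial_product g m (flip n \<omega>) = partial_product g m \<omega>" if "m \<le> n" for m
    using that by (induction m) (auto simp: flip_def)
  show ?thesis
    using \<open>n < N\<close>
  proof (induction N)
    case (Suc N)
    have pc: "partial_product g N \<omega> \<in> carrier G" using g by (simp add: partial_product_closed)
    show ?case
    proof (cases "N = n")
      case True
      then show ?thesis using pc g below[of n] by (auto simp: flip_def m_assoc)
    next
      case False
      then have "partial_product g (Suc N) (flip n \<omega>) =
          (partial_product g N \<omega> \<otimes> (if \<omega> n then inv g n else g n)) \<otimes> (if \<omega> N then g N else \<one>)"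
        using Suc by (simp add: flip_def)
      then show ?thesis using pc g by (auto simp: m_ac)
    qed
  qed simp
qed

text \<open>
  The choice of \<open>g n\<close> has to avoid finitely many translates of the meager set \<open>P\<close>, and to stay in the open
  neighbourhood of the identity given by the smallness condition, which is a finite intersection
  because there are only finitely many partial products of length \<open>n\<close>. The neighbourhood is
  non-meager.
\<close>

lemma exists_scattered_sequence:
  assumes M: "Metric_space (carrier G) d" and Td: "T = Metric_space.mtopology (carrier G) d"
    and P: "P \<subseteq> carrier G" "meager_in T P"
  shows "\<exists>g. \<forall>n. g n \<in> carrier G \<and> (\<forall>m<n. g n \<otimes> g m \<notin> P \<and> g n \<otimes> inv g m \<notin> P) \<and>
    (\<forall>\<omega>. d (partial_product g n \<omega>) (partial_product g n \<omega> \<otimes> g n) < (1 / 2) ^ n)"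
proof (rule dependent_wellorder_choice)
  interpret Metric_space "carrier G" d by fact
  fix n :: nat and f
  assume f: "\<And>m. m < n \<Longrightarrow> f m \<in> carrier G \<and> (\<forall>k<m. f m \<otimes> f k \<notin> P \<and> f m \<otimes> inv f k \<notin> P) \<and>
    (\<forall>\<omega>. d (partial_product f m \<omega>) (partial_product f m \<omega> \<otimes> f m) < (1 / 2) ^ m)"
  let ?S = "range (partial_product f n)"
  have S: "?S \<subseteq> carrier G" using f partial_product_closed by blast
  define O' where "O' = (\<Inter>p\<in>?S. {r \<in> topspace T. p \<otimes> r \<in> mball p ((1 / 2) ^ n)}) \<inter> topspace T"
  have "openin T O'"
    unfolding O'_def
  proof (rule openin_INT[OF finite_range_partial_product])
    fix p assume "p \<in> ?S"
    then have "p \<in> carrier G" using S by blast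
    then show "openin T {r \<in> topspace T. p \<otimes> r \<in> mball p ((1 / 2) ^ n)}"
      by (intro openin_continuous_map_preimage[OF continuous_map_left_translation]) (auto simp: Td)
  qed
  moreover have "\<one> \<in> O'" unfolding O'_def using S by (auto simp: topspace_eq subset_iff)
  ultimately have "\<not> meager_in T O'" using not_meager_in_open[OF completely_metrizable] by blast
  define N where "N = (\<Union>m<n. (f m <# P) \<union> (inv f m <# P))"
  have "meager_in T N"
    unfolding N_def using f P(2) by (intro meager_in_Union) (auto intro!: meager_in_Un meager_in_l_coset)
  then obtain r where r: "r \<in> O'" "r \<notin> N"
    using \<open>\<not> meager_in T O'\<close> meager_in_subset by blast
  have rG: "r \<in> carrier G" using r(1) unfolding O'_def topspace_eq by blast
  have "r \<otimes> f m \<notin> P \<and> r \<otimes> inv f m \<notin> P" if m: "m < n" for m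
  proof -
    have fm: "f m \<in> carrier G" using f m by blast
    have "r = inv f m \<otimes> (r \<otimes> f m)" "r = f m \<otimes> (r \<otimes> inv f m)"
      using rG fm m_lcomm[of "inv f m" r "f m"] m_lcomm[of "f m" r "inv f m"] by auto
    then show ?thesis using r(2) m unfolding N_def l_coset_def by blast
  qed
  moreover have "d (partial_product f n \<omega>) (partial_product f n \<omega> \<otimes> r) < (1 / 2) ^ n" for \<omega>
  proof -
    have "partial_product f n \<omega> \<otimes> r \<in> mball (partial_product f n \<omega>) ((1 / 2) ^ n)"
      using r(1) unfolding O'_def by blast
    then show ?thesis by simp
  qed
  ultimately show "\<exists>r. r \<in> carrier G \<and> (\<forall>m<n. r \<otimes> f m \<notin> P \<and> r \<otimes> inv f m \<notin> P) \<and>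
      (\<forall>\<omega>. d (partial_product f n \<omega>) (partial_product f n \<omega> \<otimes> r) < (1 / 2) ^ n)"
    using rG by blast
next
  fix r and f g :: "nat \<Rightarrow> 'a" and n :: nat
  assume eq: "\<And>m. m < n \<Longrightarrow> f m = g m"
  then have "partial_product f n \<omega> = partial_product g n \<omega>" for \<omega>
    by (rule partial_product_cong)
  then show "(r \<in> carrier G \<and> (\<forall>m<n. r \<otimes> f m \<notin> P \<and> r \<otimes> inv f m \<notin> P) \<and>
      (\<forall>\<omega>. d (partial_product f n \<omega>) (partial_product f n \<omega> \<otimes> r) < (1 / 2) ^ n)) =
    (r \<in> carrier G \<and> (\<forall>m<n. r \<otimes> g m \<notin> P \<and> r \<otimes> inv g m \<notin> P) \<and>
      (\<forall>\<omega>. d (partial_product g n \<omega>) (partial_product g n \<omega> \<otimes> r) < (1 / 2) ^ n))"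
    using eq by auto
qed

text \<open>
  The partial products form a Cauchy sequence, uniformly in \<open>\<omega>\<close>, and \<open>\<phi>\<close> is their limit. As the \<open>n\<close>-th
  partial product is within \<open>2 * (1 / 2) ^ n\<close> of the limit and depends on finitely many coins only,
  the preimage of an open set under \<open>\<phi>\<close> is a countable union of events that each
  depend on finitely many coins.
\<close>

lemma infinite_product:
  assumes M: "Metric_space (carrier G) d" and Td: "T = Metric_space.mtopology (carrier G) d"
    and compl: "Metric_space.mcomplete (carrier G) d"
    and g: "\<And>n. g n \<in> carrier G"
    and small: "\<And>n \<omega>. d (partial_product g n \<omega>) (partial_product g n \<omega> \<otimes> g n) < (1 / 2) ^ n"
  shows "\<exists>\<phi>. \<phi> \<in> measurable coin_space (sigma (topspace T) {U. openin T U}) \<and>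
    (\<forall>\<omega> n. \<phi> (flip n \<omega>) = \<phi> \<omega> \<otimes> (if \<omega> n then inv g n else g n))"
proof -
  interpret Metric_space "carrier G" d by fact
  let ?p = "partial_product g"
  have pc: "?p n \<omega> \<in> carrier G" for n \<omega> using g by (simp add: partial_product_closed)
  have step: "d (?p n \<omega>) (?p (Suc n) \<omega>) \<le> (1 / 2) ^ n" for n \<omega>
    using small[of n \<omega>] pc[of n \<omega>] by auto
  have tail: "d (?p n \<omega>) (?p (n + k) \<omega>) \<le> 2 * (1 / 2) ^ n - 2 * (1 / 2) ^ (n + k)" for n k \<omega>
  proof (induction k)
    case 0
    show ?case using pc by simp
  next
    case (Suc k)
    have "d (?p n \<omega>) (?p (n + Suc k) \<omega>) \<le> d (?p n \<omega>) (?p (n + k) \<omega>) + d (?p (n + k) \<omega>) (?p (Suc (n + k)) \<omega>)"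
      using triangle[OF pc pc pc, of n \<omega> "Suc (n + k)" \<omega> "n + k" \<omega>] by (simp only: add_Suc_right)
    also have "\<dots> \<le> (2 * (1 / 2) ^ n - 2 * (1 / 2) ^ (n + k)) + (1 / 2) ^ (n + k)"
      by (intro add_mono Suc.IH step)
    finally show ?case by (simp add: field_simps)
  qed
  have tail2: "d (?p n \<omega>) (?p m \<omega>) \<le> 2 * (1 / 2) ^ n" if "n \<le> m" for n m \<omega>
  proof -
    have "d (?p n \<omega>) (?p m \<omega>) \<le> 2 * (1 / 2) ^ n - 2 * (1 / 2) ^ m"
      using tail[of n \<omega> "m - n"] that by simp
    moreover have "0 \<le> (1 / 2 :: real) ^ m" by simp
    ultimately show ?thesis by linarith
  qed
  have lim0: "\<exists>N. 4 * (1 / 2) ^ N < e" if "e > 0" for e :: real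
    using real_arch_pow_inv[of "e / 4" "1/2"] that by (auto simp: field_simps)
  have "\<exists>l. limitin mtopology (\<lambda>n. ?p n \<omega>) l sequentially" for \<omega>
  proof -
    have "MCauchy (\<lambda>n. ?p n \<omega>)"
      unfolding MCauchy_def
    proof (intro conjI allI impI)
      fix e :: real assume "e > 0"
      then obtain N where N: "4 * (1 / 2) ^ N < e" using lim0 by blast
      have "d (?p n \<omega>) (?p n' \<omega>) < e" if "N \<le> n" "N \<le> n'" for n n'
        using triangle[OF pc[of n \<omega>] pc[of N \<omega>] pc[of n' \<omega>]] tail2[OF that(1), of \<omega>]
          tail2[OF that(2), of \<omega>] N commute[of "?p n \<omega>" "?p N \<omega>"] by linarith
      then show "\<exists>N. \<forall>n n'. N \<le> n \<longrightarrow> N \<le> n' \<longrightarrow> d (?p n \<omega>) (?p n' \<omega>) < e" by blast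
    qed (use pc in auto)
    then show ?thesis using compl unfolding mcomplete_def by blast
  qed
  then obtain \<phi> where \<phi>: "\<And>\<omega>. limitin mtopology (\<lambda>n. ?p n \<omega>) (\<phi> \<omega>) sequentially" by metis
  have \<phi>G: "\<phi> \<omega> \<in> carrier G" for \<omega> using \<phi>[of \<omega>] by (simp add: limit_metric_sequentially)
  have close: "d (?p n \<omega>) (\<phi> \<omega>) \<le> 2 * (1 / 2) ^ n" for n \<omega>
  proof (rule field_le_epsilon)
    fix e :: real assume "e > 0"
    then obtain K where K: "\<And>m. m \<ge> K \<Longrightarrow> d (?p m \<omega>) (\<phi> \<omega>) < e"
      using \<phi>[of \<omega>] unfolding limit_metric_sequentially by meson
    show "d (?p n \<omega>) (\<phi> \<omega>) \<le> 2 * (1 / 2) ^ n + e"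
      using triangle[OF pc[of n \<omega>] pc[of "max n K" \<omega>] \<phi>G[of \<omega>]] K[of "max n K"]
        tail2[of n "max n K" \<omega>] by simp
  qed
  have meas: "\<phi> \<in> measurable coin_space (sigma (topspace T) {U. openin T U})"
  proof (rule measurable_measure_of)
    show "{U. openin T U} \<subseteq> Pow (topspace T)" using openin_subset by blast
    show "\<phi> \<in> space coin_space \<rightarrow> topspace T" using \<phi>G by (simp add: topspace_eq)
    fix U assume "U \<in> {U. openin T U}"
    then have U: "openin mtopology U" by (simp add: Td)
    have "\<phi> -` U = (\<Union>n. {\<omega>. mcball (?p n \<omega>) (2 * (1 / 2) ^ n) \<subseteq> U})"
    proof (intro equalityI subsetI)
      fix \<omega> assume "\<omega> \<in> \<phi> -` U"
      then obtain e where e: "e > 0" "mball (\<phi> \<omega>) e \<subseteq> U" using U unfolding openin_mtopology by blast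
      obtain n where n: "4 * (1 / 2) ^ n < e" using lim0 e by blast
      have "mcball (?p n \<omega>) (2 * (1 / 2) ^ n) \<subseteq> mball (\<phi> \<omega>) e"
      proof
        fix y assume "y \<in> mcball (?p n \<omega>) (2 * (1 / 2) ^ n)"
        then have y: "y \<in> carrier G" "d (?p n \<omega>) y \<le> 2 * (1 / 2) ^ n" by auto
        have "d (\<phi> \<omega>) y < e"
          using triangle[OF \<phi>G[of \<omega>] pc[of n \<omega>] y(1)] close[of n \<omega>] y(2) n
            commute[of "\<phi> \<omega>" "?p n \<omega>"] by linarith
        then show "y \<in> mball (\<phi> \<omega>) e" using y(1) \<phi>G by simp
      qed
      then show "\<omega> \<in> (\<Union>n. {\<omega>. mcball (?p n \<omega>) (2 * (1 / 2) ^ n) \<subseteq> U})" using e(2) by blast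
    next
      fix \<omega> assume "\<omega> \<in> (\<Union>n. {\<omega>. mcball (?p n \<omega>) (2 * (1 / 2) ^ n) \<subseteq> U})"
      then obtain n where "mcball (?p n \<omega>) (2 * (1 / 2) ^ n) \<subseteq> U" by blast
      moreover have "\<phi> \<omega> \<in> mcball (?p n \<omega>) (2 * (1 / 2) ^ n)" using close pc \<phi>G by simp
      ultimately show "\<omega> \<in> \<phi> -` U" by blast
    qed
    moreover have "{\<omega>. mcball (?p n \<omega>) (2 * (1 / 2) ^ n) \<subseteq> U} \<in> sets coin_space" for n
      by (rule partial_product_measurable)
    ultimately show "\<phi> -` U \<inter> space coin_space \<in> sets coin_space" by auto
  qed
  have "\<phi> (flip n \<omega>) = \<phi> \<omega> \<otimes> (if \<omega> n then inv g n else g n)" for \<omega> n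
  proof -
    define u where "u = (if \<omega> n then inv g n else g n)"
    have u: "u \<in> carrier G" using g by (simp add: u_def)
    have "continuous_map T T (\<lambda>x. x \<otimes> u)"
      using u by (intro continuous_map_mult) (auto simp: topspace_eq)
    then have "limitin mtopology (\<lambda>N. ?p N \<omega> \<otimes> u) (\<phi> \<omega> \<otimes> u) sequentially"
      using continuous_map_limit[OF _ \<phi>[of \<omega>]] unfolding Td o_def by blast
    moreover have "\<forall>\<^sub>F N in sequentially. ?p N \<omega> \<otimes> u = ?p N (flip n \<omega>)"
      using eventually_gt_at_top[of n]
      by eventually_elim (use partial_product_flip[of g, OF g] in \<open>simp add: u_def\<close>)
    ultimately have "limitin mtopology (\<lambda>N. ?p N (flip n \<omega>)) (\<phi> \<omega> \<otimes> u) sequentially"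
      by (rule limitin_transform_eventually[rotated])
    then show ?thesis
      using limitin_metric_unique[OF \<phi>[of "flip n \<omega>"]] unfolding u_def by simp
  qed
  then show ?thesis using meas by blast
qed

text \<open>
  For \<open>e \<notin> P\<close> the coset \<open>e P\<close> is analytic and disjoint from \<open>P\<close>, so Lusin separation gives a Borel set
  \<open>B e \<supseteq> P\<close> disjoint from \<open>e P\<close>. Keeping only those \<open>x \<in> B e\<close> with \<open>e x \<notin> B e\<close> still leaves a Borel set
  containing \<open>P\<close>, and this set is disjoint from its own translate by \<open>e\<close>.
\<close>

lemma analytic_subgroup_borel_hull:
  assumes Z: "completely_metrizable_space Z" "separable_space Z" and f: "continuous_map Z T f"
    and P: "subgroup P G" "P = f ` topspace Z"
    and D: "countable D" "D \<subseteq> carrier G - P"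
  shows "\<exists>B \<in> borel_sets_of T. P \<subseteq> B \<and> (\<forall>e\<in>D. B \<inter> (e <# B) = {})"
proof -
  interpret sigma_algebra "topspace T" "borel_sets_of T" by (rule sigma_algebra_borel_sets_of)
  have "\<exists>B \<in> borel_sets_of T. P \<subseteq> B \<and> B \<inter> (e <# P) = {}" if e: "e \<in> D" for e
  proof -
    have eG: "e \<in> carrier G" "e \<notin> P" using e D(2) by auto
    have "P \<inter> (e <# P) = {}"
    proof -
      have False if "e \<otimes> p \<in> P" "p \<in> P" for p
      proof -
        have "(e \<otimes> p) \<otimes> inv p \<in> P"
          using that subgroup.m_closed[OF P(1)] subgroup.m_inv_closed[OF P(1)] by blast
        then show False
          using eG subgroup.mem_carrier[OF P(1) that(2)] by (simp add: m_assoc)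
      qed
      then show ?thesis unfolding l_coset_def by blast
    qed
    moreover have "e <# P = (\<lambda>z. e \<otimes> f z) ` topspace Z"
      unfolding l_coset_eq_image P(2) by (simp add: image_image)
    moreover have "continuous_map Z T (\<lambda>z. e \<otimes> f z)"
      using continuous_map_compose[OF f continuous_map_left_translation[OF eG(1)]] by (simp add: o_def)
    ultimately have "borel_separable T P (e <# P)"
      using Lusin_separation[OF Hausdorff Z Z f, of "\<lambda>z. e \<otimes> f z"] P(2) by simp
    then show ?thesis unfolding borel_separable_def by blast
  qed
  then obtain B where B: "\<And>e. e \<in> D \<Longrightarrow> B e \<in> borel_sets_of T" "\<And>e. e \<in> D \<Longrightarrow> P \<subseteq> B e"
    "\<And>e. e \<in> D \<Longrightarrow> B e \<inter> (e <# P) = {}" by metis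
  define C where "C e = B e \<inter> {x \<in> topspace T. e \<otimes> x \<in> topspace T - B e}" for e
  have C: "C e \<in> borel_sets_of T" if "e \<in> D" for e
    unfolding C_def
    by (intro Int B(1) that borel_sets_of_preimage[OF continuous_map_left_translation] compl_sets)
      (use that D(2) in blast)
  have PC: "P \<subseteq> C e" if e: "e \<in> D" for e
  proof
    fix p assume p: "p \<in> P"
    have "p \<in> carrier G" using p subgroup.mem_carrier[OF P(1)] by blast
    moreover have "e \<in> carrier G" using e D(2) by blast
    moreover have "e \<otimes> p \<notin> B e" using B(3)[OF e] p unfolding l_coset_def by blast
    ultimately show "p \<in> C e" unfolding C_def using B(2)[OF e] p by (auto simp: topspace_eq)
  qed
  have disj: "C e \<inter> (e <# C e) = {}" for e
    unfolding C_def l_coset_def by blast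
  have CI: "topspace T \<inter> (\<Inter>e\<in>D. C e) \<in> borel_sets_of T"
  proof (cases "D = {}")
    case False
    then show ?thesis using C D(1) by (intro Int top countable_INT') auto
  qed simp
  moreover have "P \<subseteq> topspace T \<inter> (\<Inter>e\<in>D. C e)"
    using PC subgroup.subset[OF P(1)] topspace_eq by blast
  moreover have "(topspace T \<inter> (\<Inter>e\<in>D. C e)) \<inter> (e <# (topspace T \<inter> (\<Inter>e\<in>D. C e))) = {}" if "e \<in> D" for e
    using disj[of e] that unfolding l_coset_def by blast
  ultimately show ?thesis by blast
qed

text \<open>
  The measure is the distribution of the infinite random product of a scattered sequence \<open>g\<close>. If the
  product lay in the translate \<open>c B\<close> of the Borel hull both after the \<open>n\<close>-th and after the \<open>m\<close>-th flip,
  two elements of \<open>B\<close> would differ by a quotient of \<open>(g n)\<^sup>\<plusminus>\<^sup>1\<close> and \<open>(g m)\<^sup>\<plusminus>\<^sup>1\<close>, which the choice of \<open>B\<close>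
  excludes.
\<close>

theorem meager_analytic_subgroup_Haar_null:
  assumes Z: "completely_metrizable_space Z" "separable_space Z" and f: "continuous_map Z T f"
    and P: "subgroup P G" "P = f ` topspace Z" and meager: "meager_in T P"
  shows "P \<in> Haar_ideal G T"
proof -
  obtain M d where "Metric_space M d" and "Metric_space.mcomplete M d"
    and Td: "T = Metric_space.mtopology M d"
    using completely_metrizable unfolding completely_metrizable_space_def by blast
  moreover have "M = carrier G"
    using topspace_eq Td Metric_space.topspace_mtopology[OF \<open>Metric_space M d\<close>] by simp
  ultimately have d: "Metric_space (carrier G) d" "T = Metric_space.mtopology (carrier G) d"
    "Metric_space.mcomplete (carrier G) d" by auto
  obtain g where g: "\<And>n. g n \<in> carrier G"
    "\<And>m n. m < n \<Longrightarrow> g n \<otimes> g m \<notin> P" "\<And>m n. m < n \<Longrightarrow> g n \<otimes> inv g m \<notin> P"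
    "\<And>n \<omega>. d (partial_product g n \<omega>) (partial_product g n \<omega> \<otimes> g n) < (1 / 2) ^ n"
    using exists_scattered_sequence[OF d(1,2) subgroup.subset[OF P(1)] meager] by metis
  obtain \<phi> where meas: "\<phi> \<in> measurable coin_space (sigma (topspace T) {U. openin T U})"
    and flip: "\<And>\<omega> n. \<phi> (flip n \<omega>) = \<phi> \<omega> \<otimes> (if \<omega> n then inv g n else g n)"
    using infinite_product[OF d g(1) g(4)] by metis
  \<comment> \<open>the factor by which flipping a coin that showed \<open>b\<close> changes the product\<close>
  define s where "s b n = (if b then inv g n else g n)" for b n
  have s: "s b n \<in> carrier G" for b n using g(1) by (simp add: s_def)
  have scattered: "s b n \<otimes> inv s c m \<notin> P" if "m < n" for b c m n
  proof
    assume "s b n \<otimes> inv s c m \<in> P"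
    then have "inv (s b n \<otimes> inv s c m) \<in> P" "s b n \<otimes> inv s c m \<in> P"
      using subgroup.m_inv_closed[OF P(1)] by auto
    then show False
      using g(1)[of n] g(1)[of m] g(2,3)[OF that]
      by (cases b; cases c) (auto simp: s_def inv_mult)
  qed
  define D where "D = (\<lambda>(n, m, b, c). s b n \<otimes> inv s c m) ` {(n, m, b, c). m \<noteq> n}"
  have "s b n \<otimes> inv s c m \<notin> P" if ne: "m \<noteq> n" for b c m n
  proof (cases "m < n")
    case True
    then show ?thesis by (rule scattered)
  next
    case False
    then have "s c m \<otimes> inv s b n \<notin> P" using ne by (intro scattered) simp
    moreover have "inv (s b n \<otimes> inv s c m) = s c m \<otimes> inv s b n"
      using s by (simp add: inv_mult m_comm)
    ultimately show ?thesis using subgroup.m_inv_closed[OF P(1)] by metis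
  qed
  then have "D \<subseteq> carrier G - P" unfolding D_def using s by auto
  moreover have "countable D" unfolding D_def by (intro countable_image countableI_type)
  ultimately obtain B where B: "B \<in> borel_sets_of T" "P \<subseteq> B" "\<And>e. e \<in> D \<Longrightarrow> B \<inter> (e <# B) = {}"
    using analytic_subgroup_borel_hull[OF Z f P] by metis
  define \<mu> where "\<mu> = distr coin_space (sigma (topspace T) {U. openin T U}) \<phi>"
  have sets_\<mu>: "sets \<mu> = borel_sets_of T"
    unfolding \<mu>_def borel_sets_of_def sets_distr
    by (rule sets_measure_of) (auto dest: openin_subset)
  have \<mu>: "borel_prob_measure T \<mu>"
    unfolding borel_prob_measure_def using sets_\<mu> prob_space.prob_space_distr[OF prob_space_coin_space meas]
    by (simp add: \<mu>_def)
  have null: "emeasure \<mu> (c <# B) = 0" if c: "c \<in> carrier G" for c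
  proof -
    have cB: "c <# B \<in> sets \<mu>" using borel_sets_of_l_coset[OF c B(1)] sets_\<mu> by simp
    define Q where "Q = \<phi> -` (c <# B)"
    have Q: "Q \<in> sets coin_space"
      using measurable_sets[OF meas, of "c <# B"] cB unfolding \<mu>_def Q_def by simp
    have "disjoint_family (\<lambda>n. flip n -` Q)"
      unfolding disjoint_family_on_def
    proof (intro ballI impI)
      fix n m :: nat assume nm: "n \<noteq> m"
      have False if n: "\<omega> \<in> flip n -` Q" and m: "\<omega> \<in> flip m -` Q" for \<omega>
      proof -
        let ?u = "s (\<omega> n) n" and ?v = "s (\<omega> m) m"
        obtain b where b: "b \<in> B" "\<phi> \<omega> \<otimes> ?u = c \<otimes> b"
          using n unfolding Q_def l_coset_def by (auto simp: flip s_def)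
        obtain b' where b': "b' \<in> B" "\<phi> \<omega> \<otimes> ?v = c \<otimes> b'"
          using m unfolding Q_def l_coset_def by (auto simp: flip s_def)
        have bG: "b \<in> carrier G" "b' \<in> carrier G"
          using b(1) b'(1) borel_sets_of_subset[OF B(1)] topspace_eq by auto
        have \<phi>G: "\<phi> \<omega> \<in> carrier G"
          using measurable_space[OF meas, of \<omega>] openin_subset by (simp add: topspace_eq space_measure_of_conv)
        have "c \<otimes> b = c \<otimes> ((?u \<otimes> inv ?v) \<otimes> b')"
        proof -
          have "c \<otimes> ((?u \<otimes> inv ?v) \<otimes> b') = (?u \<otimes> inv ?v) \<otimes> (c \<otimes> b')"
            using c bG s by (simp add: m_ac)
          also have "\<dots> = (?u \<otimes> inv ?v) \<otimes> (?v \<otimes> \<phi> \<omega>)"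
            using b'(2) s \<phi>G by (simp add: m_comm)
          also have "\<dots> = ?u \<otimes> \<phi> \<omega>"
            using s \<phi>G by (simp add: m_assoc[of ?u "inv ?v" "?v \<otimes> \<phi> \<omega>"]
                m_assoc[of "inv ?v" ?v "\<phi> \<omega>", symmetric])
          also have "\<dots> = \<phi> \<omega> \<otimes> ?u" using s \<phi>G by (simp add: m_comm)
          finally show ?thesis using b(2) by simp
        qed
        then have "b = (?u \<otimes> inv ?v) \<otimes> b'" using c bG s by simp
        then have "b \<in> (?u \<otimes> inv ?v) <# B" using b'(1) unfolding l_coset_def by blast
        moreover have "?u \<otimes> inv ?v \<in> D" unfolding D_def
          by (rule image_eqI[of _ _ "(n, m, \<omega> n, \<omega> m)"]) (use nm in auto)
        ultimately show False using B(3) b(1) by blast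
      qed
      then show "flip n -` Q \<inter> flip m -` Q = {}" by blast
    qed
    then have "emeasure coin_space Q = 0" by (rule disjoint_flips_imp_null[OF Q])
    then show ?thesis
      using emeasure_distr[OF meas, of "c <# B"] cB unfolding \<mu>_def Q_def by simp
  qed
  have "emeasure \<mu> ((x <# B) #> y) = 0" if "x \<in> carrier G" "y \<in> carrier G" for x y
  proof -
    have "(x <# B) #> y = (x \<otimes> y) <# B"
    proof -
      have "(x \<otimes> b) \<otimes> y = (x \<otimes> y) \<otimes> b" if "b \<in> B" for b
      proof -
        have "b \<in> carrier G" using that borel_sets_of_subset[OF B(1)] topspace_eq by auto
        then show ?thesis using \<open>x \<in> _\<close> \<open>y \<in> _\<close> by (simp add: m_ac)
      qed
      then show ?thesis unfolding l_coset_def r_coset_def by auto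
    qed
    then show ?thesis using null[of "x \<otimes> y"] that by simp
  qed
  then have "Haar_null_Borel G T B"
    unfolding Haar_null_Borel_def using B(1) \<mu> by blast
  then show ?thesis unfolding Haar_ideal_def using B(2) by blast
qed

end

section \<open>Products of closed subgroups\<close>

text \<open>
  The product set is the image of the Polish group \<open>A \<times> B\<close> under multiplication, which is a
  homomorphism because the group is commutative. So the open mapping theorem and the Haar nullness of
  meager analytic subgroups both apply to it.
\<close>

theorem (in abelian_polish_group) subgroup_product_open_iff:
  assumes A: "subgroup A G" "closedin T A" and B: "subgroup B G" "closedin T B"
  shows "A <#> B \<notin> Haar_ideal G T \<longleftrightarrow> openin T (A <#> B)"
    and "openin T (A <#> B) \<longleftrightarrow> \<not> meager_in T (A <#> B)"
proof -
  let ?K = "G\<lparr>carrier := A\<rparr> \<times>\<times> G\<lparr>carrier := B\<rparr>"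
  let ?S = "prod_topology (subtopology T A) (subtopology T B)"
  let ?m = "\<lambda>z. fst z \<otimes> snd z"
  have K: "polish_group ?K ?S"
    by (intro polish_group_DirProd polish_group_closed_subgroup polish_group_axioms A B)
  interpret K: polish_group ?K ?S by (rule K)
  have "A \<subseteq> carrier G" "B \<subseteq> carrier G" using A(1) B(1) by (simp_all add: subgroup.subset)
  then have hom: "?m \<in> hom ?K G"
    by (intro homI) (auto simp: mult_DirProd' m_ac subset_iff)
  have cont: "continuous_map ?S T ?m"
    by (intro continuous_map_mult)
      (auto intro: continuous_map_into_fulltopology continuous_map_fst continuous_map_snd)
  have image: "?m ` carrier ?K = A <#> B"
    unfolding set_mult_def by force
  interpret m: group_hom ?K G ?m using hom by unfold_locales
  have P: "subgroup (A <#> B) G" using m.img_is_subgroup image by simp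
  have "\<one> \<in> A <#> B" using subgroup.one_closed[OF P] .
  then have ne: "A <#> B \<noteq> {}" by blast
  show open_iff: "openin T (A <#> B) \<longleftrightarrow> \<not> meager_in T (A <#> B)"
    using not_meager_in_open[OF completely_metrizable _ ne]
      nonmeager_hom_image_open[OF K polish_group_axioms hom cont] image by metis
  have "A <#> B \<in> Haar_ideal G T" if "meager_in T (A <#> B)"
    using meager_analytic_subgroup_Haar_null[OF K.completely_metrizable K.separable cont P _ that]
      image K.topspace_eq by simp
  then show "A <#> B \<notin> Haar_ideal G T \<longleftrightarrow> openin T (A <#> B)"
    using open_not_Haar_null[OF _ ne] open_iff by blast
qed

section \<open>Pointwise stabilizers\<close>

lemma (in group_action) pointwise_stabilizer_subgroup:
  assumes "X \<subseteq> E"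
  shows "subgroup (pointwise_stabilizer G \<phi> X) G"
proof -
  interpret group G using group_hom by (rule group_hom.axioms(1))
  show ?thesis
  proof (cases "X = {}")
    case True
    then have "pointwise_stabilizer G \<phi> X = carrier G" by (simp add: pointwise_stabilizer_def)
    then show ?thesis by (simp add: subgroup_self)
  next
    case False
    then have "pointwise_stabilizer G \<phi> X = (\<Inter>x\<in>X. stabilizer G \<phi> x)"
      unfolding pointwise_stabilizer_def stabilizer_def by blast
    moreover have "subgroup (\<Inter>x\<in>X. stabilizer G \<phi> x) G"
      using assms False stabilizer_subgroup by (intro subgroups_Inter) auto
    ultimately show ?thesis by simp
  qed
qed

lemma closedin_pointwise_stabilizer:
  assumes top: "topspace T = carrier G" and M: "G_structure G T M \<phi>" and X: "X \<subseteq> M"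
  shows "closedin T (pointwise_stabilizer G \<phi> X)"
proof (cases "X = {}")
  case True
  then have "pointwise_stabilizer G \<phi> X = topspace T" by (simp add: pointwise_stabilizer_def top)
  then show ?thesis by simp
next
  case False
  then have "pointwise_stabilizer G \<phi> X = (\<Inter>x\<in>X. stabilizer G \<phi> x)"
    unfolding pointwise_stabilizer_def stabilizer_def by blast
  then show ?thesis
    using False X M unfolding G_structure_def by (auto intro!: closedin_Inter)
qed

theorem theorem13:
  fixes G :: "('a, 'b) monoid_scheme" and T :: "'a topology"
    and M :: "'m set" and \<phi> :: "'a \<Rightarrow> 'm \<Rightarrow> 'm"
    and a b C :: "'m tuple_or_subset"
  assumes "polish_group G T"
    and "comm_group G"
    and "G_structure G T M \<phi>"
    and "finite_in M a" and "finite_in M b" and "finite_in M C"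
  shows "(indep_Haar G T \<phi> a C b \<longleftrightarrow> indep_o G T \<phi> a C b) \<and>
         (indep_o G T \<phi> a C b \<longleftrightarrow> indep_nm G T \<phi> a C b)"
proof -
  interpret G: polish_group G T by fact
  interpret G: comm_group G by fact
  interpret group_action G M \<phi> using assms(3) unfolding G_structure_def by blast
  define H where "H X = pointwise_stabilizer G \<phi> (entries C \<union> X)" for X
  let ?A = "H (entries a)" and ?B = "H (entries b)" and ?C = "H {}"
  have M: "entries C \<union> entries a \<subseteq> M" "entries C \<union> entries b \<subseteq> M" "entries C \<union> {} \<subseteq> M"
    using assms(4-6) unfolding finite_in_def by auto
  have sub: "subgroup ?A G" "subgroup ?B G" "subgroup ?C G"
    unfolding H_def by (intro pointwise_stabilizer_subgroup M)+
  have cl: "closedin T ?A" "closedin T ?B" "closedin T ?C"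
    unfolding H_def by (intro closedin_pointwise_stabilizer[OF G.topspace_eq assms(3)] M)+
  have le: "?A \<subseteq> ?C" "?B \<subseteq> ?C"
    unfolding H_def pointwise_stabilizer_def by auto
  let ?G = "G\<lparr>carrier := ?C\<rparr>" and ?T = "subtopology T ?C"
  interpret C: group ?G by (rule G.subgroup_imp_group[OF sub(3)])
  have comm: "comm_group ?G"
    by (rule C.group_comm_groupI) (use subgroup.mem_carrier[OF sub(3)] G.m_comm in auto)
  \<comment> \<open>All three relations concern subgroups of \<open>G\<^sub>C\<close>, so the ambient group is replaced by \<open>G\<^sub>C\<close>.\<close>
  interpret GC: abelian_polish_group ?G ?T
    unfolding abelian_polish_group_def
    by (intro conjI polish_group_closed_subgroup G.polish_group_axioms sub cl comm)
  have sub': "subgroup ?A ?G" "subgroup ?B ?G"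
    by (intro G.subgroup_incl sub le)+
  have cl': "closedin ?T ?A" "closedin ?T ?B"
    using cl le by (simp_all add: closedin_closed_subtopology)
  have prod: "stab_product G \<phi> a C b = ?A <#>\<^bsub>?G\<^esub> ?B"
    unfolding stab_product_def H_def set_mult_def by simp
  have stab: "stab_group G \<phi> C = ?G" "stab_topology G T \<phi> C = ?T"
    unfolding stab_group_def stab_topology_def H_def by simp_all
  show ?thesis
    unfolding indep_Haar_def indep_o_def indep_nm_def prod stab
    using GC.subgroup_product_open_iff[OF sub'(1) cl'(1) sub'(2) cl'(2)] by blast
qed

end
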